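(* Let $\mathbf P$ be a self-similar RAM constructed from i.i.d. fractions $\mathbf X=\{X_j\}_{j\ge1}$, and let $\mathbf T$ be an independent homogeneous Markov chain on the discrete space $\mathcal X$ with kernel $Q$ and initial distribution $\mu$, where $\mu$ assigns zero mass to transient states of $Q$. Let $\nu=\langle\sum_{j\ge1}P_j\delta_{T_j}(l):l\in\mathcal X\rangle$. For each recurrent state $i$ of $Q$, let $\mathbf T^i$ be a Markov chain with kernel $Q$ and $T^i_1=i$, independent of $\mathbf X$ and of $(\nu,T_1)$; let $W^i=\inf\{j>1:T^i_j=i\}$, $X^i=\sum_{j=1}^{W^i-1}X_j\prod_{l=1}^{j-1}(1-X_l)$, $\eta^i=(X^i)^{-1}\sum_{j=1}^{W^i-1}\big[X_j\prod_{l=1}^{j-1}(1-X_l)\big]\delta_{T^i_j}$, and let $\nu^i$ denote the conditional law of $\nu$ given $T_1=i$. Then the law of $(\nu,T_1)$ is the unique law satisfying: $T_1\sim\mu$ and, for each recurrent state $i$ of $Q$, $\nu^i\overset d=X^i\eta^i+(1-X^i)\tilde\nu^i$, where $\tilde\nu^i$ has the same law as $\nu^i$ and is independent of $(\eta^i,X^i)$.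
   Context: Conventions: empty sums $0$, empty products $1$. A RAM constructed from independent $[0,1]$-valued fractions $X_j$ is $P_j=X_j\prod_{i<j}(1-X_i)$, required to satisfy $\sum_jP_j=1$ a.s.; it is self-similar if the $X_j$ are i.i.d. *)

theory Defs
  imports "HOL-Probability.Probability"
begin

text \<open>A kernel on the countable discrete space 'x is Q :: 'x => 'x pmf.
  first_passage Q i n j is the probability that the chain started at j
  hits i for the first time (after time 0) exactly at step n.\<close>

fun first_passage :: "('x \<Rightarrow> 'x pmf) \<Rightarrow> 'x \<Rightarrow> nat \<Rightarrow> 'x \<Rightarrow> ennreal" where
  "first_passage Q i 0 j = 0"
| "first_passage Q i (Suc 0) j = ennreal (pmf (Q j) i)"
| "first_passage Q i (Suc (Suc n)) j =
     (\<integral>\<^sup>+ k. (if k = i then 0 else first_passage Q i (Suc n) k) \<partial>measure_pmf (Q j))"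

definition recurrent_state :: "('x \<Rightarrow> 'x pmf) \<Rightarrow> 'x \<Rightarrow> bool" where
  "recurrent_state Q i \<longleftrightarrow> (\<Sum>n. first_passage Q i (Suc n) i) = 1"

definition transient_state :: "('x \<Rightarrow> 'x pmf) \<Rightarrow> 'x \<Rightarrow> bool" where
  "transient_state Q i \<longleftrightarrow> \<not> recurrent_state Q i"

text \<open>T = (T_1, T_2, ...) (index 0 unused) is a homogeneous Markov chain on M with
  kernel Q and initial distribution mu (finite-dimensional distributions).\<close>
definition markov_chain ::
  "'a measure \<Rightarrow> ('x \<Rightarrow> 'x pmf) \<Rightarrow> 'x pmf \<Rightarrow> (nat \<Rightarrow> 'a \<Rightarrow> 'x) \<Rightarrow> bool" where
  "markov_chain M Q \<mu> T \<longleftrightarrow>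
     (\<forall>j\<ge>1. T j \<in> measurable M (count_space UNIV)) \<and>
     (\<forall>n\<ge>1. \<forall>s :: nat \<Rightarrow> 'x.
        measure M {\<omega> \<in> space M. \<forall>k\<in>{1..n}. T k \<omega> = s k}
          = pmf \<mu> (s 1) * (\<Prod>k\<in>{1..<n}. pmf (Q (s k)) (s (Suc k))))"

text \<open>Independence of two random variables with values in possibly different
  measurable spaces (the library's indep_var requires equal value types).\<close>
definition indep_rv :: "'a measure \<Rightarrow> 'b measure \<Rightarrow> ('a \<Rightarrow> 'b) \<Rightarrow> 'c measure \<Rightarrow> ('a \<Rightarrow> 'c) \<Rightarrow> bool" where
  "indep_rv M Ma f Mb g \<longleftrightarrow>
     f \<in> measurable M Ma \<and> g \<in> measurable M Mb \<and>
     (\<forall>A\<in>sets Ma. \<forall>B\<in>sets Mb.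
        measure M (f -` A \<inter> g -` B \<inter> space M)
          = measure M (f -` A \<inter> space M) * measure M (g -` B \<inter> space M))"

definition ram_weight :: "(nat \<Rightarrow> 'a \<Rightarrow> real) \<Rightarrow> nat \<Rightarrow> 'a \<Rightarrow> real" where
  "ram_weight X j \<omega> = X j \<omega> * (\<Prod>l\<in>{1..<j}. (1 - X l \<omega>))"

definition ram_nu :: "(nat \<Rightarrow> 'a \<Rightarrow> real) \<Rightarrow> (nat \<Rightarrow> 'a \<Rightarrow> 'x) \<Rightarrow> 'a \<Rightarrow> 'x \<Rightarrow> real" where
  "ram_nu X T \<omega> = (\<lambda>l. \<Sum>j. ram_weight X (Suc j) \<omega> * (if T (Suc j) \<omega> = l then 1 else 0))"

abbreviation pm_space :: "('x \<Rightarrow> real) measure" where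
  "pm_space \<equiv> PiM UNIV (\<lambda>_. borel)"

abbreviation law_space :: "(('x \<Rightarrow> real) \<times> 'x) measure" where
  "law_space \<equiv> pm_space \<Otimes>\<^sub>M count_space UNIV"

definition return_time :: "'x \<Rightarrow> (nat \<Rightarrow> 'a \<Rightarrow> 'x) \<Rightarrow> 'a \<Rightarrow> nat" where
  "return_time i S \<omega> = (LEAST j. 1 < j \<and> S j \<omega> = i)"

definition cycle_mass :: "(nat \<Rightarrow> 'a \<Rightarrow> real) \<Rightarrow> 'x \<Rightarrow> (nat \<Rightarrow> 'a \<Rightarrow> 'x) \<Rightarrow> 'a \<Rightarrow> real" where
  "cycle_mass X i S \<omega> = (\<Sum>j\<in>{1..<return_time i S \<omega>}. ram_weight X j \<omega>)"

text \<open>eta^i = (X^i)^{-1} sum_{j=1}^{W^i - 1} P_j delta_{T^i_j}  (inverse 0 = 0).\<close>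
definition cycle_meas :: "(nat \<Rightarrow> 'a \<Rightarrow> real) \<Rightarrow> 'x \<Rightarrow> (nat \<Rightarrow> 'a \<Rightarrow> 'x) \<Rightarrow> 'a \<Rightarrow> 'x \<Rightarrow> real" where
  "cycle_meas X i S \<omega> = (\<lambda>l. inverse (cycle_mass X i S \<omega>) *
      (\<Sum>j\<in>{1..<return_time i S \<omega>}. ram_weight X j \<omega> * (if S j \<omega> = l then 1 else 0)))"

definition cond_law :: "(('x \<Rightarrow> real) \<times> 'x) measure \<Rightarrow> 'x \<Rightarrow> ('x \<Rightarrow> real) measure" where
  "cond_law L i = distr (uniform_measure L {p \<in> space L. snd p = i}) pm_space fst"

text \<open>The characterising property of a law L of (nu, T_1): T_1 ~ mu, and for every
  recurrent i (with mu i > 0, so that conditioning makes sense)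
  nu^i =d X^i eta^i + (1 - X^i) nu~^i with nu~^i ~ nu^i independent of (X^i, eta^i);
  K i is the joint law of (X^i, eta^i).\<close>
definition ram_fixpoint_law ::
  "('x \<Rightarrow> 'x pmf) \<Rightarrow> 'x pmf \<Rightarrow> ('x \<Rightarrow> (real \<times> ('x \<Rightarrow> real)) measure)
     \<Rightarrow> (('x \<Rightarrow> real) \<times> 'x) measure \<Rightarrow> bool" where
  "ram_fixpoint_law Q \<mu> K L \<longleftrightarrow>
     distr L (count_space UNIV) snd = measure_pmf \<mu> \<and>
     (\<forall>i. recurrent_state Q i \<and> pmf \<mu> i > 0 \<longrightarrow>
        cond_law L i =
          distr (K i \<Otimes>\<^sub>M cond_law L i) pm_space
            (\<lambda>((x, \<eta>), \<nu>'). \<lambda>l. x * \<eta> l + (1 - x) * \<nu>' l))"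

end

(* Conditionally on T_1 = i, the chain T has the law of T^i, so nu^i is the law of the random
   measure built from X and T^i.  Cutting T^i at its first return to i, which happens almost
   surely because i is recurrent, the strong Markov property and the i.i.d. fractions show that
   what follows is an independent copy of the whole picture, scaled by the remaining mass
   prod_{l < W} (1 - X_l) = 1 - X^i.  This is the fixed-point equation.

   For uniqueness, the fixed-point map sends a test function f that is c-Lipschitz in finitely
   many coordinates to one that is (c E[1 - X^i])-Lipschitz.  Since sum_j P_j = 1 the fractions
   do not vanish almost surely, and X^i >= X_1, so E[1 - X^i] < 1; iterating the map shows that
   two fixed points supported on [0,1]-valued functions integrate every such f equally. *)

theory Submission
  imports Defs
begin

text \<open>The obstacle is the random cut: cycle and remainder both depend on the return time, so
  neither independence of blocks of fractions nor the Markov property applies to them directly.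
  Instead of a stopping-time calculus, countability of the state space is used: there are countably
  many pairs of a cycle length n and a path of n states. On each such event the cut is at the fixed
  time n, the cycle is a function of X_1, ..., X_n, and everything after n starts afresh from i. The
  sum over these events is a product law, because the factor of the remainder is the same for every
  path. The laws live on the product sigma-algebra of functions from states to reals, generated by
  orthants in finitely many coordinates; this dictates test functions of finitely many coordinates.
  Comparing two fixed points needs a starting bound, and there the values in [0,1] enter: over a
  finite set J two such functions are at l1-distance at most |J|.\<close>

declare One_nat_def [simp del]

section \<open>Stick-breaking weights\<close>

text \<open>Each weight is the drop of the remaining stick, prod_{l<j} (1 - X_l) minus the same
  product over l <= j, so the sum telescopes. It identifies 1 - X^i with the stick left at the end
  of a cycle.\<close>

lemma sum_ram_weight: "(\<Sum>j\<in>{1..n}. ram_weight X j \<omega>) = 1 - (\<Prod>l\<in>{1..n}. 1 - X l \<omega>)"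
proof (induction n)
  case (Suc n)
  have "{1..<Suc n} = {1..n}" by auto
  then show ?case using Suc by (simp add: ram_weight_def algebra_simps)
qed simp

text \<open>Self-similarity at the level of a single outcome: what is left after n breaks is broken
  by the shifted fractions in the same manner.\<close>

lemma ram_weight_shift:
  assumes "j \<ge> 1"
  shows "ram_weight X (j + n) \<omega> =
    (\<Prod>l\<in>{1..n}. 1 - X l \<omega>) * ram_weight (\<lambda>j. X (j + n)) j \<omega>"
proof -
  have "{1..<j + n} = {1..n} \<union> {1 + n..<j + n}" "{1..n} \<inter> {1 + n..<j + n} = {}"
    using assms by auto
  then have "(\<Prod>l\<in>{1..<j + n}. 1 - X l \<omega>) =
      (\<Prod>l\<in>{1..n}. 1 - X l \<omega>) * (\<Prod>l\<in>{1 + n..<j + n}. 1 - X l \<omega>)"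
    by (simp add: prod.union_disjoint)
  also have "(\<Prod>l\<in>{1 + n..<j + n}. 1 - X l \<omega>) = (\<Prod>l\<in>{1..<j}. 1 - X (l + n) \<omega>)"
    by (rule prod.shift_bounds_nat_ivl)
  finally show ?thesis by (simp add: ram_weight_def)
qed

lemma ram_weight_nonneg:
  assumes "\<And>j. j \<ge> 1 \<Longrightarrow> X j \<omega> \<in> {0..1}" "j \<ge> 1"
  shows "0 \<le> ram_weight X j \<omega>"
  unfolding ram_weight_def using assms by (intro mult_nonneg_nonneg prod_nonneg) auto

lemma sum_ram_weight_Suc_le:
  assumes "\<And>j. j \<ge> 1 \<Longrightarrow> X j \<omega> \<in> {0..1}"
  shows "(\<Sum>j<n. ram_weight X (Suc j) \<omega>) \<le> 1"
proof -
  have "(\<Sum>j<n. ram_weight X (Suc j) \<omega>) = (\<Sum>j\<in>{1..n}. ram_weight X j \<omega>)"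
    using sum.shift_bounds_Suc_ivl[of "\<lambda>j. ram_weight X j \<omega>" 0 n]
    by (simp add: lessThan_atLeast0 atLeastLessThanSuc_atLeastAtMost One_nat_def)
  then show ?thesis
    using assms by (auto simp: sum_ram_weight intro!: prod_nonneg)
qed

text \<open>By telescoping the partial sums are at most 1 at every outcome, so the series for nu
  converges everywhere and no null set has to be carried along.\<close>

lemma summable_ram_weight:
  assumes "\<And>j. j \<ge> 1 \<Longrightarrow> X j \<omega> \<in> {0..1}"
  shows "summable (\<lambda>j. ram_weight X (Suc j) \<omega> * (if P j then 1 else 0))"
proof (rule bounded_imp_summable[where B = 1])
  show "0 \<le> ram_weight X (Suc j) \<omega> * (if P j then 1 else 0)" for j
    using ram_weight_nonneg[of X \<omega>, OF assms] by simp
  show "(\<Sum>j\<le>n. ram_weight X (Suc j) \<omega> * (if P j then 1 else 0)) \<le> 1" for n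
  proof -
    have "(\<Sum>j\<le>n. ram_weight X (Suc j) \<omega> * (if P j then 1 else 0)) \<le> (\<Sum>j\<le>n. ram_weight X (Suc j) \<omega>)"
      using ram_weight_nonneg[of X \<omega>, OF assms] by (intro sum_mono) auto
    also have "\<dots> \<le> 1"
      using sum_ram_weight_Suc_le[of X \<omega>, OF assms, of "Suc n"] by (simp only: lessThan_Suc_atMost)
    finally show ?thesis .
  qed
qed

lemma ram_nu_in_unit:
  assumes "\<And>j. j \<ge> 1 \<Longrightarrow> X j \<omega> \<in> {0..1}"
  shows "ram_nu X T \<omega> l \<in> {0..1}"
proof -
  have "ram_nu X T \<omega> l \<le> 1"
    unfolding ram_nu_def
  proof (rule suminf_le_const[OF summable_ram_weight[of X \<omega>, OF assms]])
    show "(\<Sum>j<n. ram_weight X (Suc j) \<omega> * (if T (Suc j) \<omega> = l then 1 else 0)) \<le> 1" for n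
      using ram_weight_nonneg[of X \<omega>, OF assms]
      by (intro order.trans[OF sum_mono sum_ram_weight_Suc_le[of X \<omega>, OF assms]]) auto
  qed
  moreover have "0 \<le> ram_nu X T \<omega> l"
    unfolding ram_nu_def using ram_weight_nonneg[of X \<omega>, OF assms]
    by (intro suminf_nonneg summable_ram_weight[of X \<omega>, OF assms]) auto
  ultimately show ?thesis by simp
qed

text \<open>A pathwise identity for every n, which permits taking n to be the random length of the
  first cycle later on.\<close>

lemma ram_nu_split:
  assumes "\<And>j. j \<ge> 1 \<Longrightarrow> X j \<omega> \<in> {0..1}"
  shows "ram_nu X T \<omega> l =
    (\<Sum>j\<in>{1..n}. ram_weight X j \<omega> * (if T j \<omega> = l then 1 else 0)) +
    (\<Prod>l\<in>{1..n}. 1 - X l \<omega>) * ram_nu (\<lambda>j. X (j + n)) (\<lambda>j. T (j + n)) \<omega> l"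
proof -
  let ?f = "\<lambda>j. ram_weight X j \<omega> * (if T j \<omega> = l then 1 else 0)"
  let ?g = "\<lambda>j. ram_weight (\<lambda>j. X (j + n)) (Suc j) \<omega> * (if T (Suc j + n) \<omega> = l then 1 else 0)"
  have "ram_nu X T \<omega> l = (\<Sum>j. ?f (Suc (j + n))) + (\<Sum>j<n. ?f (Suc j))"
    unfolding ram_nu_def
    using suminf_split_initial_segment[OF summable_ram_weight[of X \<omega>, OF assms]] by simp
  also have "(\<Sum>j<n. ?f (Suc j)) = (\<Sum>j\<in>{1..n}. ?f j)"
    using sum.shift_bounds_Suc_ivl[of ?f 0 n]
    by (simp add: lessThan_atLeast0 atLeastLessThanSuc_atLeastAtMost One_nat_def)
  also have "(\<lambda>j. ?f (Suc (j + n))) = (\<lambda>j. (\<Prod>l\<in>{1..n}. 1 - X l \<omega>) * ?g j)"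
    using ram_weight_shift[of "Suc _" X n \<omega>] by (simp add: fun_eq_iff)
  also have "suminf \<dots> = (\<Prod>l\<in>{1..n}. 1 - X l \<omega>) * suminf ?g"
    using assms by (intro suminf_mult summable_ram_weight) auto
  also have "suminf ?g = ram_nu (\<lambda>j. X (j + n)) (\<lambda>j. T (j + n)) \<omega> l"
    by (simp add: ram_nu_def)
  finally show ?thesis by simp
qed

section \<open>Regeneration of the fractions and of the chain\<close>

abbreviation (input) frac_seqs :: "(nat \<Rightarrow> real) measure" where
  "frac_seqs \<equiv> PiM {1..} (\<lambda>_. borel)"

abbreviation (input) state_seqs :: "(nat \<Rightarrow> 'x) measure" where
  "state_seqs \<equiv> PiM {1..} (\<lambda>_. count_space UNIV)"

text \<open>Restricted to \<open>{1..}\<close> because points of the product space must be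
  extensional.\<close>

definition seq_shift :: "nat \<Rightarrow> (nat \<Rightarrow> 'b) \<Rightarrow> nat \<Rightarrow> 'b" where
  "seq_shift n f = (\<lambda>j\<in>{1..}. f (j + n))"

lemma measurable_seq_shift [measurable]:
  "seq_shift n \<in> measurable (PiM {1..} (\<lambda>_. N)) (PiM {1..} (\<lambda>_. N))"
  unfolding seq_shift_def by measurable

lemma ram_weight_cong:
  "(\<And>j. j \<ge> 1 \<Longrightarrow> X j \<omega> = X' j \<omega>') \<Longrightarrow> j \<ge> 1 \<Longrightarrow> ram_weight X j \<omega> = ram_weight X' j \<omega>'"
  unfolding ram_weight_def by (intro arg_cong2[where f = times] prod.cong) auto

lemma ram_nu_cong:
  assumes "\<And>j. j \<ge> 1 \<Longrightarrow> X j \<omega> = X' j \<omega>'" "\<And>j. j \<ge> 1 \<Longrightarrow> T j \<omega> = T' j \<omega>'"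
  shows "ram_nu X T \<omega> = ram_nu X' T' \<omega>'"
  using ram_weight_cong[of X \<omega> X' \<omega>'] assms by (simp add: ram_nu_def)

text \<open>\<open>ram_nu\<close> with the pair of sequences itself as the outcome. Events about nu
  thereby become events about the fractions and states, to which regeneration applies.\<close>

definition nu_of :: "(nat \<Rightarrow> real) \<times> (nat \<Rightarrow> 'x) \<Rightarrow> 'x \<Rightarrow> real" where
  "nu_of = ram_nu (\<lambda>j p. fst p j) (\<lambda>j p. snd p j)"

lemma measurable_nu_of [measurable]:
  "nu_of \<in> measurable (frac_seqs \<Otimes>\<^sub>M state_seqs) (pm_space :: ('x::countable \<Rightarrow> real) measure)"
proof (rule measurable_PiM_single')
  fix l :: 'x
  have [measurable]: "(\<lambda>p::(nat \<Rightarrow> real) \<times> (nat \<Rightarrow> 'x). fst p j) \<in> borel_measurable (frac_seqs \<Otimes>\<^sub>M state_seqs)"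
    if "j \<ge> 1" for j
    using that by (intro measurable_compose[OF measurable_fst measurable_component_singleton]) auto
  have [measurable]: "(\<lambda>p::(nat \<Rightarrow> real) \<times> (nat \<Rightarrow> 'x). snd p j) \<in> measurable (frac_seqs \<Otimes>\<^sub>M state_seqs) (count_space UNIV)"
    if "j \<ge> 1" for j
    using that by (intro measurable_compose[OF measurable_snd measurable_component_singleton]) auto
  have "(\<lambda>p. ram_weight (\<lambda>j p. fst p j) (Suc j) p * (if snd p (Suc j) = l then 1 else 0)) \<in>
      borel_measurable (frac_seqs \<Otimes>\<^sub>M state_seqs)" for j
    unfolding ram_weight_def by measurable
  then show "(\<lambda>p. nu_of p l) \<in> borel_measurable (frac_seqs \<Otimes>\<^sub>M state_seqs)"
    unfolding nu_of_def ram_nu_def by (rule borel_measurable_suminf)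
qed auto

lemma ram_nu_eq_nu_of:
  "ram_nu X T \<omega> = nu_of (restrict (\<lambda>j. X j \<omega>) {1..}, restrict (\<lambda>j. T j \<omega>) {1..})"
  unfolding nu_of_def by (intro ram_nu_cong) auto

lemma ram_nu_shift_eq_nu_of:
  "ram_nu (\<lambda>j. X (j + n)) (\<lambda>j. T (j + n)) \<omega> =
    nu_of (seq_shift n (\<lambda>j. X j \<omega>), seq_shift n (\<lambda>j. T j \<omega>))"
  unfolding nu_of_def by (intro ram_nu_cong) (auto simp: seq_shift_def)

section \<open>Laws on path space are determined by cylinders\<close>

definition cylinder :: "nat \<Rightarrow> (nat \<Rightarrow> 'x) \<Rightarrow> (nat \<Rightarrow> 'x) set" where
  "cylinder m r = {t \<in> space state_seqs. \<forall>k\<in>{1..m}. t k = r k}"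

lemma sets_cylinder [measurable, simp]: "cylinder m r \<in> sets (state_seqs :: (nat \<Rightarrow> 'x::countable) measure)"
  unfolding cylinder_def by measurable

text \<open>For the nontrivial inclusion the coordinate maps are shown measurable for the cylinder
  sigma-algebra: the event t_k = x is the union of the cylinders over all paths of length k ending
  in x, and countability of the state space makes this union countable.\<close>

lemma sets_state_seqs_cylinders:
  "sets (state_seqs :: (nat \<Rightarrow> 'x::countable) measure) =
    sigma_sets (space state_seqs) (insert {} (range (\<lambda>(m, r). cylinder m r)))"
    (is "_ = sigma_sets _ ?E")
proof

  have *: "?E \<subseteq> Pow (space state_seqs)"
    by (auto simp: cylinder_def)
  show "sigma_sets (space state_seqs) ?E \<subseteq> sets (state_seqs :: (nat \<Rightarrow> 'x) measure)"
    by (intro sets.sigma_sets_subset) (auto)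
  have "(\<lambda>t::nat \<Rightarrow> 'x. t) \<in> measurable (sigma (space state_seqs) ?E) state_seqs"
  proof (rule measurable_PiM_single')
    fix k :: nat assume k: "k \<in> {1..}"
    have "(\<lambda>t. t k) -` {x} \<inter> space state_seqs \<in> sigma_sets (space state_seqs) ?E" for x :: 'x
    proof -
      let ?R = "{r \<in> {1..k} \<rightarrow>\<^sub>E UNIV. r k = x}"
      have "(\<lambda>t. t k) -` {x} \<inter> space state_seqs = (\<Union>r\<in>?R. cylinder k r)"
      proof safe
        fix t :: "nat \<Rightarrow> 'x" assume "t \<in> space state_seqs" "x = t k"
        then show "t \<in> (\<Union>r\<in>{r \<in> {1..k} \<rightarrow>\<^sub>E UNIV. r k = t k}. cylinder k r)"
          using k by (intro UN_I[of "restrict t {1..k}"]) (auto simp: cylinder_def)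
      qed (use k in \<open>auto simp: cylinder_def\<close>)
      also have "countable ?R"
        by (rule countable_subset[OF _ countable_PiE[of "{1..k}" "\<lambda>_. UNIV"]]) auto
      then have "(\<Union>r\<in>?R. cylinder k r) \<in> sets (sigma (space state_seqs) ?E)"
        using * by (intro sets.countable_UN'') auto
      then have "(\<Union>r\<in>?R. cylinder k r) \<in> sigma_sets (space state_seqs) ?E"
        using * by (subst (asm) sets_measure_of) auto
      finally show ?thesis .
    qed
    then show "(\<lambda>t. t k) \<in> measurable (sigma (space state_seqs) ?E) (count_space (UNIV :: 'x set))"
      using * by (subst measurable_count_space_eq2_countable) (auto simp: sets_measure_of space_measure_of)
  qed (use * in \<open>auto simp: space_measure_of space_PiM\<close>)
  then show "sets (state_seqs :: (nat \<Rightarrow> 'x) measure) \<subseteq> sigma_sets (space state_seqs) ?E"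
    using * by (auto dest!: measurable_sets simp: space_measure_of sets_measure_of sets.sets_into_space Int_absorb2 vimage_ident)
qed

text \<open>Of two cylinders the longer one is contained in the shorter one or disjoint from it, so
  adding the empty set yields an intersection-stable generator.\<close>

lemma state_seqs_measure_eqI:
  fixes N1 N2 :: "(nat \<Rightarrow> 'x::countable) measure"
  assumes "sets N1 = sets state_seqs" "sets N2 = sets state_seqs" "finite_measure N1"
    and eq: "\<And>m r. emeasure N1 (cylinder m r) = emeasure N2 (cylinder m r)"
  shows "N1 = N2"
proof (rule measure_eqI_generator_eq[where E = "insert {} (range (\<lambda>(m, r). cylinder m r))"
      and \<Omega> = "space state_seqs" and A = "\<lambda>_. cylinder 0 undefined"])
  have "cylinder m r \<inter> cylinder m' r' \<in> insert {} (range (\<lambda>(m, r). cylinder m r))"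
    if le: "m \<le> m'" for m m' and r r' :: "nat \<Rightarrow> 'x"
  proof (cases "\<forall>k\<in>{1..m}. r k = r' k")
    case True
    then have "cylinder m r \<inter> cylinder m' r' = cylinder m' r'"
      using le by (auto simp: cylinder_def)
    then show ?thesis by auto
  next
    case False
    then have "cylinder m r \<inter> cylinder m' r' = {}"
      using le by (fastforce simp: cylinder_def)
    then show ?thesis by auto
  qed
  then have *: "cylinder m r \<inter> cylinder m' r' \<in> insert {} (range (\<lambda>(m, r). cylinder m r))"
    for m m' and r r' :: "nat \<Rightarrow> 'x"
    by (metis Int_commute nle_le)
  show "Int_stable (insert {} (range (\<lambda>(m, r). cylinder m r :: (nat \<Rightarrow> 'x) set)))"
  proof (rule Int_stableI)
    fix a b :: "(nat \<Rightarrow> 'x) set"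
    assume "a \<in> insert {} (range (\<lambda>(m, r). cylinder m r))" "b \<in> insert {} (range (\<lambda>(m, r). cylinder m r))"
    then consider "a = {} \<or> b = {}" | m r m' r' where "a = cylinder m r" "b = cylinder m' r'"
      by auto
    then show "a \<inter> b \<in> insert {} (range (\<lambda>(m, r). cylinder m r))"
      by cases (use * in auto)
  qed
  \<comment> \<open>A cylinder over an empty index set constrains nothing, so it serves as the
    exhausting sequence of sets.\<close>
  have 0: "cylinder 0 r = space state_seqs" for r :: "nat \<Rightarrow> 'x"
    by (simp add: cylinder_def)
  show "(\<Union>i::nat. cylinder 0 undefined) = space (state_seqs :: (nat \<Rightarrow> 'x) measure)"
    by (simp add: 0)
  show "insert {} (range (\<lambda>(m, r). cylinder m r)) \<subseteq> Pow (space (state_seqs :: (nat \<Rightarrow> 'x) measure))"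
    by (auto simp: cylinder_def)
  show "emeasure N1 (cylinder 0 undefined) \<noteq> \<infinity>"
    using assms(3) by (simp add: finite_measure.emeasure_finite)
  show "sets N1 = sigma_sets (space state_seqs) (insert {} (range (\<lambda>(m, r). cylinder m r)))"
    "sets N2 = sigma_sets (space state_seqs) (insert {} (range (\<lambda>(m, r). cylinder m r)))"
    using assms(1,2) by (simp_all add: sets_state_seqs_cylinders)
qed (use eq in auto)

section \<open>Restart of the chain and of the fractions at a deterministic time\<close>

lemma markov_chain_measurable:
  assumes "markov_chain M Q \<mu> T" "j \<ge> 1"
  shows "T j \<in> measurable M (count_space UNIV)"
  using assms by (auto simp: markov_chain_def)

lemma markov_chain_path:
  assumes "prob_space M" "markov_chain M Q \<mu> T" "n \<ge> 1"
  shows "emeasure M {\<omega> \<in> space M. \<forall>k\<in>{1..n}. T k \<omega> = s k} =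
    ennreal (pmf \<mu> (s 1) * (\<Prod>k\<in>{1..<n}. pmf (Q (s k)) (s (Suc k))))"
  using assms by (simp add: markov_chain_def prob_space_def finite_measure.emeasure_eq_measure)

text \<open>Both sides are finite measures in \<open>D\<close>, so it suffices to take cylinders,
  where the product formula for paths splits at time n + 1. For n = 0 the prefix is empty and the
  left factor is the probability of starting in i.\<close>

lemma markov_regeneration:
  fixes T S :: "nat \<Rightarrow> 'a \<Rightarrow> 'x::countable"
  assumes M: "prob_space M" and T: "markov_chain M Q \<mu> T" and S: "markov_chain M Q (return_pmf i) S"
    and D: "D \<in> sets state_seqs"
  shows "emeasure M {\<omega> \<in> space M. (\<forall>k\<in>{1..n}. T k \<omega> = s k) \<and> T (Suc n) \<omega> = i \<and>
      seq_shift n (\<lambda>j. T j \<omega>) \<in> D} =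
    emeasure M {\<omega> \<in> space M. (\<forall>k\<in>{1..n}. T k \<omega> = s k) \<and> T (Suc n) \<omega> = i} *
    emeasure M {\<omega> \<in> space M. restrict (\<lambda>j. S j \<omega>) {1..} \<in> D}"
proof -
  interpret prob_space M by fact
  define A where "A = {\<omega> \<in> space M. (\<forall>k\<in>{1..n}. T k \<omega> = s k) \<and> T (Suc n) \<omega> = i}"
  have [measurable]: "T j \<in> measurable M (count_space UNIV)" "S j \<in> measurable M (count_space UNIV)"
    if "j \<ge> 1" for j
    using that T S by (auto intro: markov_chain_measurable)
  have [measurable]: "A \<in> sets M"
    unfolding A_def by measurable
  let ?f = "\<lambda>\<omega>. seq_shift n (\<lambda>j. T j \<omega>)" and ?g = "\<lambda>\<omega>. restrict (\<lambda>j. S j \<omega>) {1..}"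
  have f [measurable]: "?f \<in> measurable M state_seqs"
    unfolding seq_shift_def by measurable
  have g [measurable]: "?g \<in> measurable M state_seqs"
    by measurable
  \<comment> \<open>The law of the shifted chain on the event \<open>A\<close>, left unnormalised so
    that a null event needs no separate treatment.\<close>
  define N1 where "N1 = distr (density M (indicator A)) state_seqs ?f"
  define N2 where "N2 = scale_measure (emeasure M A) (distr M state_seqs ?g)"
  have N1: "emeasure N1 E = emeasure M {\<omega> \<in> A. ?f \<omega> \<in> E}" if [measurable]: "E \<in> sets state_seqs" for E
  proof -
    have "emeasure N1 E = emeasure (density M (indicator A)) (?f -` E \<inter> space M)"
      unfolding N1_def by (subst emeasure_distr) auto
    also have "\<dots> = emeasure M (A \<inter> (?f -` E \<inter> space M))"
      by (rule emeasure_restricted) auto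
    also have "A \<inter> (?f -` E \<inter> space M) = {\<omega> \<in> A. ?f \<omega> \<in> E}"
      by (auto simp: A_def)
    finally show ?thesis .
  qed
  have N2: "emeasure N2 E = emeasure M A * emeasure M {\<omega> \<in> space M. ?g \<omega> \<in> E}"
    if [measurable]: "E \<in> sets state_seqs" for E
  proof -
    have "?g -` E \<inter> space M = {\<omega> \<in> space M. ?g \<omega> \<in> E}"
      by auto
    then show ?thesis
      unfolding N2_def by (simp add: emeasure_distr)
  qed
  have "N1 = N2"
  proof (rule state_seqs_measure_eqI)
    show "finite_measure N1"
    proof
      have "emeasure N1 (space N1) \<le> emeasure M A"
        by (subst N1) (auto simp: N1_def intro!: emeasure_mono)
      then show "emeasure N1 (space N1) \<noteq> \<infinity>"
        by (auto simp: top_unique)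
    qed
    fix m and r :: "nat \<Rightarrow> 'x"
    have S_cyl: "{\<omega> \<in> space M. ?g \<omega> \<in> cylinder m r} = {\<omega> \<in> space M. \<forall>k\<in>{1..m}. S k \<omega> = r k}"
      by (auto simp: cylinder_def space_PiM)
    have T_cyl: "{\<omega> \<in> A. ?f \<omega> \<in> cylinder m r} = {\<omega> \<in> A. \<forall>k\<in>{1..m}. T (k + n) \<omega> = r k}"
      by (auto simp: cylinder_def space_PiM seq_shift_def)
    have *: "emeasure M {\<omega> \<in> A. \<forall>k\<in>{1..m}. T (k + n) \<omega> = r k} =
      emeasure M A * emeasure M {\<omega> \<in> space M. \<forall>k\<in>{1..m}. S k \<omega> = r k}"
    proof (cases "m = 0")
      case True
      then show ?thesis by (simp add: emeasure_space_1)
    next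
      case m: False
      show ?thesis
      proof (cases "r 1 = i")
        \<comment> \<open>\<open>A\<close> puts the shifted chain at i at its first index, and S
          starts at i, so both sides vanish.\<close>
        case False
        then have "{\<omega> \<in> A. \<forall>k\<in>{1..m}. T (k + n) \<omega> = r k} = {}"
          using m by (auto simp: A_def plus_1_eq_Suc dest!: bspec[of "{1..m}" _ 1])
        moreover have "emeasure M {\<omega> \<in> space M. \<forall>k\<in>{1..m}. S k \<omega> = r k} = 0"
          using False m by (subst markov_chain_path[OF M S]) auto
        ultimately show ?thesis by (simp only: emeasure_empty mult_zero_right)
      next
        case True
        \<comment> \<open>The concatenated path. Its entry at n + 1 is r_1 = i, so it also serves as
          the path that defines \<open>A\<close>.\<close>
        define u where "u k = (if k \<le> n then s k else r (k - n))" for k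
        have "u 1 = (if n = 0 then i else s 1)"
          using True by (auto simp: u_def)
        have A: "A = {\<omega> \<in> space M. \<forall>k\<in>{1..Suc n}. T k \<omega> = u k}"
          using True by (auto simp: A_def u_def atLeastAtMostSuc_conv One_nat_def)
        have split: "{1..n + m} = {1..n} \<union> (\<lambda>k. k + n) ` {1..m}"
          by (auto simp: image_iff)
        have "(\<forall>k\<in>{1..n + m}. T k \<omega> = u k) \<longleftrightarrow>
            (\<forall>k\<in>{1..n}. T k \<omega> = s k) \<and> (\<forall>k\<in>{1..m}. T (k + n) \<omega> = r k)" for \<omega>
          unfolding split ball_Un by (simp add: u_def del: image_add_atLeastAtMost')
        moreover have "T (Suc n) \<omega> = i" if "\<forall>k\<in>{1..m}. T (k + n) \<omega> = r k" for \<omega>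
          using that m True by (auto simp: plus_1_eq_Suc dest!: bspec[of "{1..m}" _ 1])
        ultimately have "{\<omega> \<in> A. \<forall>k\<in>{1..m}. T (k + n) \<omega> = r k} =
            {\<omega> \<in> space M. \<forall>k\<in>{1..n + m}. T k \<omega> = u k}"
          unfolding A_def by blast
        \<comment> \<open>The first block includes the transition into time n + 1; the second begins
          with the transition out of it, which is the first step of S.\<close>
        moreover have "(\<Prod>k\<in>{1..<n + m}. pmf (Q (u k)) (u (Suc k))) =
            (\<Prod>k\<in>{1..<Suc n}. pmf (Q (u k)) (u (Suc k))) * (\<Prod>k\<in>{1..<m}. pmf (Q (r k)) (r (Suc k)))"
        proof -
          have "{1..<n + m} = {1..<Suc n} \<union> {1 + n..<m + n}" "{1..<Suc n} \<inter> {1 + n..<m + n} = {}"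
            using m by auto
          then have "(\<Prod>k\<in>{1..<n + m}. pmf (Q (u k)) (u (Suc k))) =
            (\<Prod>k\<in>{1..<Suc n}. pmf (Q (u k)) (u (Suc k))) * (\<Prod>k\<in>{1 + n..<m + n}. pmf (Q (u k)) (u (Suc k)))"
            by (simp add: prod.union_disjoint)
          also have "(\<Prod>k\<in>{1 + n..<m + n}. pmf (Q (u k)) (u (Suc k))) =
              (\<Prod>k\<in>{1..<m}. pmf (Q (u (k + n))) (u (Suc (k + n))))"
            by (rule prod.shift_bounds_nat_ivl)
          also have "\<dots> = (\<Prod>k\<in>{1..<m}. pmf (Q (r k)) (r (Suc k)))"
            by (intro prod.cong) (auto simp: u_def Suc_diff_le)
          finally show ?thesis .
        qed
        ultimately show ?thesis
          unfolding A using m True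
          by (simp add: markov_chain_path[OF M T] markov_chain_path[OF M S] ennreal_mult[symmetric]
              prod_nonneg mult.assoc)
      qed
    qed
    then show "emeasure N1 (cylinder m r) = emeasure N2 (cylinder m r)"
      by (subst N1, simp, subst N2, simp, simp only: S_cyl T_cyl)
  qed (simp_all add: N1_def N2_def)
  then have "emeasure N1 D = emeasure N2 D" by simp
  moreover have "{\<omega> \<in> A. ?f \<omega> \<in> D} = {\<omega> \<in> space M. (\<forall>k\<in>{1..n}. T k \<omega> = s k) \<and> T (Suc n) \<omega> = i \<and> ?f \<omega> \<in> D}"
    by (auto simp: A_def)
  ultimately show ?thesis
    unfolding N1[OF D] N2[OF D] by (simp add: A_def)
qed

text \<open>Both laws are the product of the one-dimensional marginals, which agree because the
  variables are identically distributed.\<close>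

lemma iid_shift_law:
  fixes X :: "nat \<Rightarrow> 'a \<Rightarrow> 'b"
  assumes M: "prob_space M" and X: "prob_space.indep_vars M (\<lambda>_. N) X {1..}"
    and ident: "\<forall>j\<ge>1. distr M N (X j) = distr M N (X 1)"
  shows "distr M (PiM {1..} (\<lambda>_. N)) (\<lambda>\<omega>. seq_shift n (\<lambda>j. X j \<omega>)) =
    distr M (PiM {1..} (\<lambda>_. N)) (\<lambda>\<omega>. restrict (\<lambda>j. X j \<omega>) {1..})"
proof -
  interpret prob_space M by fact
  have meas: "X j \<in> measurable M N" if "j \<ge> 1" for j
    using X that by (auto simp: indep_vars_def)
  have shift: "indep_vars (\<lambda>_. N) (\<lambda>j. X (j + n)) {1..}"
    unfolding indep_vars_def2
  proof (intro conjI ballI indep_setsI)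
    fix A J assume J: "J \<noteq> {}" "J \<subseteq> {1::nat..}" "finite J"
      and A: "\<forall>j\<in>J. A j \<in> {X (j + n) -` B \<inter> space M |B. B \<in> sets N}"
    \<comment> \<open>Independence of the shifted family is independence of the original one on the
      translated index set J + n.\<close>
    have "prob (\<Inter>j\<in>(\<lambda>j. j + n) ` J. A (j - n)) = (\<Prod>j\<in>(\<lambda>j. j + n) ` J. prob (A (j - n)))"
      using X J A unfolding indep_vars_def2 by (intro indep_setsD[where I = "{1..}"]) auto
    then show "prob (\<Inter>j\<in>J. A j) = (\<Prod>j\<in>J. prob (A j))"
      by (simp add: prod.reindex)
  qed (use meas in \<open>auto intro!: measurable_sets\<close>)
  have "distr M (PiM {1..} (\<lambda>_. N)) (\<lambda>\<omega>. \<lambda>j\<in>{1..}. X (j + n) \<omega>) = PiM {1..} (\<lambda>j. distr M N (X (j + n)))"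
    using shift meas by (subst (asm) indep_vars_iff_distr_eq_PiM') auto
  also have "\<dots> = PiM {1..} (\<lambda>j. distr M N (X j))"
    by (intro PiM_cong refl trans[OF ident[rule_format] ident[rule_format, symmetric]]) auto
  also have "\<dots> = distr M (PiM {1..} (\<lambda>_. N)) (\<lambda>\<omega>. \<lambda>j\<in>{1..}. X j \<omega>)"
    using X meas by (subst (asm) indep_vars_iff_distr_eq_PiM') auto
  finally show ?thesis by (simp add: seq_shift_def)
qed

text \<open>The blocks up to n and after n use disjoint indices and are independent; the second has
  the law of the whole sequence by \<open>iid_shift_law\<close>.\<close>

lemma iid_regeneration:
  fixes X :: "nat \<Rightarrow> 'a \<Rightarrow> 'b"
  assumes M: "prob_space M" and X: "prob_space.indep_vars M (\<lambda>_. N) X {1..}"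
    and ident: "\<forall>j\<ge>1. distr M N (X j) = distr M N (X 1)"
    and B: "B \<in> sets (PiM {1..n} (\<lambda>_. N))" and E: "E \<in> sets (PiM {1..} (\<lambda>_. N))"
  shows "emeasure M {\<omega> \<in> space M. restrict (\<lambda>j. X j \<omega>) {1..n} \<in> B \<and> seq_shift n (\<lambda>j. X j \<omega>) \<in> E} =
    emeasure M {\<omega> \<in> space M. restrict (\<lambda>j. X j \<omega>) {1..n} \<in> B} *
    emeasure M {\<omega> \<in> space M. restrict (\<lambda>j. X j \<omega>) {1..} \<in> E}"
proof -
  interpret prob_space M by fact
  have [measurable]: "X j \<in> measurable M N" if "j \<ge> 1" for j
    using X that by (auto simp: indep_vars_def)
  define sh :: "(nat \<Rightarrow> 'b) \<Rightarrow> nat \<Rightarrow> 'b" where "sh x = (\<lambda>j\<in>{1..}. x (j + n))" for x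
  have sh [measurable]: "sh \<in> measurable (PiM {Suc n..} (\<lambda>_. N)) (PiM {1..} (\<lambda>_. N))"
    unfolding sh_def by measurable
  have sh_eq: "sh (restrict (\<lambda>j. X j \<omega>) {Suc n..}) = seq_shift n (\<lambda>j. X j \<omega>)" for \<omega>
    by (auto simp: sh_def seq_shift_def fun_eq_iff)
  have f [measurable]: "(\<lambda>\<omega>. seq_shift n (\<lambda>j. X j \<omega>)) \<in> measurable M (PiM {1..} (\<lambda>_. N))"
    unfolding seq_shift_def by measurable
  have "indep_var (PiM {1..n} (\<lambda>_. N)) (\<lambda>\<omega>. restrict (\<lambda>j. X j \<omega>) {1..n})
      (PiM {Suc n..} (\<lambda>_. N)) (\<lambda>\<omega>. restrict (\<lambda>j. X j \<omega>) {Suc n..})"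
    by (rule indep_var_restrict[OF X]) auto
  then have "indep_var (PiM {1..n} (\<lambda>_. N)) (id \<circ> (\<lambda>\<omega>. restrict (\<lambda>j. X j \<omega>) {1..n}))
      (PiM {1..} (\<lambda>_. N)) (sh \<circ> (\<lambda>\<omega>. restrict (\<lambda>j. X j \<omega>) {Suc n..}))"
    by (rule indep_var_compose) auto
  then have "indep_var (PiM {1..n} (\<lambda>_. N)) (\<lambda>\<omega>. restrict (\<lambda>j. X j \<omega>) {1..n})
      (PiM {1..} (\<lambda>_. N)) (\<lambda>\<omega>. seq_shift n (\<lambda>j. X j \<omega>))"
    by (simp add: comp_def sh_eq)
  from indep_varD[OF this B E]
  have "emeasure M {\<omega> \<in> space M. restrict (\<lambda>j. X j \<omega>) {1..n} \<in> B \<and> seq_shift n (\<lambda>j. X j \<omega>) \<in> E} =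
    emeasure M {\<omega> \<in> space M. restrict (\<lambda>j. X j \<omega>) {1..n} \<in> B} *
    emeasure M {\<omega> \<in> space M. seq_shift n (\<lambda>j. X j \<omega>) \<in> E}"
    by (simp add: emeasure_eq_measure ennreal_mult[symmetric] vimage_def Int_def conj_ac)
  also have "emeasure M {\<omega> \<in> space M. seq_shift n (\<lambda>j. X j \<omega>) \<in> E} =
      emeasure (distr M (PiM {1..} (\<lambda>_. N)) (\<lambda>\<omega>. seq_shift n (\<lambda>j. X j \<omega>))) E"
    using E by (subst emeasure_distr) (auto simp: vimage_def Int_def conj_ac)
  also have "\<dots> = emeasure M {\<omega> \<in> space M. restrict (\<lambda>j. X j \<omega>) {1..} \<in> E}"
    unfolding iid_shift_law[OF M X ident]
    using E by (subst emeasure_distr) (auto simp: vimage_def Int_def conj_ac)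
  finally show ?thesis .
qed

lemma emeasure_distr_eq:
  "f \<in> measurable M N \<Longrightarrow> A \<in> sets N \<Longrightarrow> emeasure (distr M N f) A = emeasure M {\<omega> \<in> space M. f \<omega> \<in> A}"
  by (auto simp: emeasure_distr intro!: arg_cong[where f = "emeasure M"])

lemma indep_rv_emeasure:
  assumes "prob_space M" "indep_rv M Ma f Mb g" "A \<in> sets Ma" "B \<in> sets Mb"
  shows "emeasure M {\<omega> \<in> space M. f \<omega> \<in> A \<and> g \<omega> \<in> B} =
    emeasure M {\<omega> \<in> space M. f \<omega> \<in> A} * emeasure M {\<omega> \<in> space M. g \<omega> \<in> B}"
proof -
  interpret prob_space M by fact
  show ?thesis
    using assms(2-) by (simp add: indep_rv_def emeasure_eq_measure ennreal_mult[symmetric] vimage_def Int_def conj_ac)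
qed

text \<open>On rectangles, independence of X and T separates the two coordinates, and each
  regenerates on its own; uniqueness of product measures extends this to all \<open>E\<close>. Two
  instances are used: n = 0, to identify conditional laws given T_1 = i, and T = S, to cut a chain
  at its first return.\<close>

lemma joint_regeneration:
  fixes T S :: "nat \<Rightarrow> 'a \<Rightarrow> 'x::countable" and X :: "nat \<Rightarrow> 'a \<Rightarrow> real"
  assumes M: "prob_space M" and X: "prob_space.indep_vars M (\<lambda>_. borel) X {1..}"
    and ident: "\<forall>j\<ge>1. distr M borel (X j) = distr M borel (X 1)"
    and T: "markov_chain M Q \<mu> T" and S: "markov_chain M Q (return_pmf i) S"
    and XT: "indep_rv M frac_seqs (\<lambda>\<omega>. restrict (\<lambda>j. X j \<omega>) {1..})
      state_seqs (\<lambda>\<omega>. restrict (\<lambda>j. T j \<omega>) {1..})"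
    and XS: "indep_rv M frac_seqs (\<lambda>\<omega>. restrict (\<lambda>j. X j \<omega>) {1..})
      state_seqs (\<lambda>\<omega>. restrict (\<lambda>j. S j \<omega>) {1..})"
    and B: "B \<in> sets (PiM {1..n} (\<lambda>_. borel))" and E: "E \<in> sets (frac_seqs \<Otimes>\<^sub>M state_seqs)"
  shows "emeasure M {\<omega> \<in> space M. restrict (\<lambda>j. X j \<omega>) {1..n} \<in> B \<and>
      (\<forall>k\<in>{1..n}. T k \<omega> = s k) \<and> T (Suc n) \<omega> = i \<and>
      (seq_shift n (\<lambda>j. X j \<omega>), seq_shift n (\<lambda>j. T j \<omega>)) \<in> E} =
    emeasure M {\<omega> \<in> space M. restrict (\<lambda>j. X j \<omega>) {1..n} \<in> B} *
    emeasure M {\<omega> \<in> space M. (\<forall>k\<in>{1..n}. T k \<omega> = s k) \<and> T (Suc n) \<omega> = i} *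
    emeasure M {\<omega> \<in> space M. (restrict (\<lambda>j. X j \<omega>) {1..}, restrict (\<lambda>j. S j \<omega>) {1..}) \<in> E}"
proof -
  interpret prob_space M by fact
  let ?X = "\<lambda>\<omega>. restrict (\<lambda>j. X j \<omega>) {1..}" and ?S = "\<lambda>\<omega>. restrict (\<lambda>j. S j \<omega>) {1..}"
  let ?T = "\<lambda>\<omega>. restrict (\<lambda>j. T j \<omega>) {1..}"
  have [measurable]: "X j \<in> borel_measurable M" if "j \<ge> 1" for j
    using X that by (auto simp: indep_vars_def)
  have [measurable]: "T j \<in> measurable M (count_space UNIV)" "S j \<in> measurable M (count_space UNIV)"
    if "j \<ge> 1" for j
    using that T S by (auto intro: markov_chain_measurable)
  have [measurable]: "(\<lambda>\<omega>. seq_shift n (\<lambda>j. X j \<omega>)) \<in> measurable M frac_seqs"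
    "(\<lambda>\<omega>. seq_shift n (\<lambda>j. T j \<omega>)) \<in> measurable M state_seqs"
    unfolding seq_shift_def by measurable
  let ?f = "\<lambda>\<omega>. (seq_shift n (\<lambda>j. X j \<omega>), seq_shift n (\<lambda>j. T j \<omega>))"
  define AX where "AX = {\<omega> \<in> space M. restrict (\<lambda>j. X j \<omega>) {1..n} \<in> B}"
  define AT where "AT = {\<omega> \<in> space M. (\<forall>k\<in>{1..n}. T k \<omega> = s k) \<and> T (Suc n) \<omega> = i}"
  note B [measurable]
  have [measurable]: "AX \<in> sets M" "AT \<in> sets M"
    unfolding AX_def AT_def by measurable
  define N1 where "N1 = distr (density M (indicator (AX \<inter> AT))) (frac_seqs \<Otimes>\<^sub>M state_seqs) ?f"
  \<comment> \<open>The probability of the past. Attached to the fraction marginal, it makes the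
    restricted law a product of two sigma-finite measures, the form that uniqueness of product
    measures requires.\<close>
  define c where "c = emeasure M AX * emeasure M AT"
  have c: "c < \<infinity>"
    by (simp add: c_def emeasure_eq_measure ennreal_mult_less_top)
  have N1: "emeasure N1 E = emeasure M {\<omega> \<in> AX \<inter> AT. ?f \<omega> \<in> E}"
    if [measurable]: "E \<in> sets (frac_seqs \<Otimes>\<^sub>M state_seqs)" for E
  proof -
    have "emeasure N1 E = emeasure (density M (indicator (AX \<inter> AT))) (?f -` E \<inter> space M)"
      unfolding N1_def by (subst emeasure_distr) auto
    also have "\<dots> = emeasure M ((AX \<inter> AT) \<inter> (?f -` E \<inter> space M))"
      by (rule emeasure_restricted) auto
    also have "(AX \<inter> AT) \<inter> (?f -` E \<inter> space M) = {\<omega> \<in> AX \<inter> AT. ?f \<omega> \<in> E}"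
      by (auto simp: AT_def)
    finally show ?thesis .
  qed
  have X_meas: "?X \<in> measurable M frac_seqs" and S_meas: "?S \<in> measurable M state_seqs"
    by measurable
  interpret X: prob_space "distr M frac_seqs ?X"
    by (rule prob_space_distr[OF X_meas])
  have sf_X: "sigma_finite_measure (scale_measure c (distr M frac_seqs ?X))"
    using c X.emeasure_space_1
    by (intro finite_measure.axioms(1) finite_measureI) (simp add: space_scale_measure)
  have sf_S: "sigma_finite_measure (distr M state_seqs ?S)"
    by (intro prob_space_imp_sigma_finite prob_space_distr S_meas)
  have "scale_measure c (distr M frac_seqs ?X) \<Otimes>\<^sub>M distr M state_seqs ?S = N1"
  proof (rule pair_measure_eqI[OF sf_X sf_S])
    fix C D assume "C \<in> sets (scale_measure c (distr M frac_seqs ?X))" "D \<in> sets (distr M state_seqs ?S)"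
    then have [measurable]: "C \<in> sets frac_seqs" "D \<in> sets state_seqs" by auto
    have "emeasure N1 (C \<times> D) = emeasure M {\<omega> \<in> AX \<inter> AT. ?f \<omega> \<in> C \<times> D}"
      by (rule N1) auto
    also have "{\<omega> \<in> AX \<inter> AT. ?f \<omega> \<in> C \<times> D} = {\<omega> \<in> space M.
        ?X \<omega> \<in> {x \<in> space frac_seqs. restrict x {1..n} \<in> B \<and> seq_shift n x \<in> C} \<and>
        ?T \<omega> \<in> {t \<in> space state_seqs. (\<forall>k\<in>{1..n}. t k = s k) \<and> t (Suc n) = i \<and> seq_shift n t \<in> D}}"
    proof -
      have "seq_shift n (?X \<omega>) = seq_shift n (\<lambda>j. X j \<omega>)" "seq_shift n (?T \<omega>) = seq_shift n (\<lambda>j. T j \<omega>)"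
        "restrict (?X \<omega>) {1..n} = restrict (\<lambda>j. X j \<omega>) {1..n}" for \<omega>
        by (auto simp: seq_shift_def fun_eq_iff)
      then show ?thesis
        by (auto simp: AX_def AT_def space_PiM)
    qed
    also have "emeasure M \<dots> =
      emeasure M {\<omega> \<in> space M. ?X \<omega> \<in> {x \<in> space frac_seqs. restrict x {1..n} \<in> B \<and> seq_shift n x \<in> C}} *
      emeasure M {\<omega> \<in> space M. ?T \<omega> \<in> {t \<in> space state_seqs. (\<forall>k\<in>{1..n}. t k = s k) \<and> t (Suc n) = i \<and> seq_shift n t \<in> D}}"
      by (intro indep_rv_emeasure[OF M XT]; measurable)
    also have "{\<omega> \<in> space M. ?X \<omega> \<in> {x \<in> space frac_seqs. restrict x {1..n} \<in> B \<and> seq_shift n x \<in> C}} =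
      {\<omega> \<in> space M. restrict (\<lambda>j. X j \<omega>) {1..n} \<in> B \<and> seq_shift n (\<lambda>j. X j \<omega>) \<in> C}"
    proof -
      have "seq_shift n (?X \<omega>) = seq_shift n (\<lambda>j. X j \<omega>)"
        "restrict (?X \<omega>) {1..n} = restrict (\<lambda>j. X j \<omega>) {1..n}" for \<omega>
        by (auto simp: seq_shift_def fun_eq_iff)
      then show ?thesis
        by (auto simp: space_PiM)
    qed
    also have "{\<omega> \<in> space M. ?T \<omega> \<in> {t \<in> space state_seqs. (\<forall>k\<in>{1..n}. t k = s k) \<and> t (Suc n) = i \<and> seq_shift n t \<in> D}} =
      {\<omega> \<in> space M. (\<forall>k\<in>{1..n}. T k \<omega> = s k) \<and> T (Suc n) \<omega> = i \<and> seq_shift n (\<lambda>j. T j \<omega>) \<in> D}"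
    proof -
      have "seq_shift n (?T \<omega>) = seq_shift n (\<lambda>j. T j \<omega>)" for \<omega>
        by (auto simp: seq_shift_def fun_eq_iff)
      then show ?thesis
        by (auto simp: space_PiM)
    qed
    also have "emeasure M {\<omega> \<in> space M. restrict (\<lambda>j. X j \<omega>) {1..n} \<in> B \<and> seq_shift n (\<lambda>j. X j \<omega>) \<in> C} =
      emeasure M AX * emeasure M {\<omega> \<in> space M. ?X \<omega> \<in> C}"
      unfolding AX_def by (rule iid_regeneration[OF M X ident]) auto
    also have "emeasure M {\<omega> \<in> space M. (\<forall>k\<in>{1..n}. T k \<omega> = s k) \<and> T (Suc n) \<omega> = i \<and> seq_shift n (\<lambda>j. T j \<omega>) \<in> D} =
      emeasure M AT * emeasure M {\<omega> \<in> space M. ?S \<omega> \<in> D}"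
      unfolding AT_def by (rule markov_regeneration[OF M T S]) auto
    finally show "emeasure (scale_measure c (distr M frac_seqs ?X)) C * emeasure (distr M state_seqs ?S) D =
        emeasure N1 (C \<times> D)"
      by (simp only: c_def emeasure_distr_eq[OF X_meas] emeasure_distr_eq[OF S_meas]
          emeasure_scale_measure \<open>C \<in> sets frac_seqs\<close> \<open>D \<in> sets state_seqs\<close> mult_ac)
  qed (auto simp: N1_def)
  \<comment> \<open>The same product arises from X and S, which are independent; so both laws agree
    on every \<open>E\<close>.\<close>
  moreover have "scale_measure c (distr M (frac_seqs \<Otimes>\<^sub>M state_seqs) (\<lambda>\<omega>. (?X \<omega>, ?S \<omega>))) =
      scale_measure c (distr M frac_seqs ?X) \<Otimes>\<^sub>M distr M state_seqs ?S"
  proof (rule pair_measure_eqI[OF sf_X sf_S, symmetric])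
    fix C D assume "C \<in> sets (scale_measure c (distr M frac_seqs ?X))" "D \<in> sets (distr M state_seqs ?S)"
    then have [measurable]: "C \<in> sets frac_seqs" "D \<in> sets state_seqs" by auto
    show "emeasure (scale_measure c (distr M frac_seqs ?X)) C * emeasure (distr M state_seqs ?S) D =
        emeasure (scale_measure c (distr M (frac_seqs \<Otimes>\<^sub>M state_seqs) (\<lambda>\<omega>. (?X \<omega>, ?S \<omega>)))) (C \<times> D)"
      using indep_rv_emeasure[OF M XS, of C D]
      by (simp add: emeasure_distr vimage_def Int_def conj_ac mult_ac)
  qed auto
  ultimately have "emeasure N1 E =
      emeasure (scale_measure c (distr M (frac_seqs \<Otimes>\<^sub>M state_seqs) (\<lambda>\<omega>. (?X \<omega>, ?S \<omega>)))) E"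
    by simp
  moreover have "{\<omega> \<in> AX \<inter> AT. ?f \<omega> \<in> E} = {\<omega> \<in> space M. restrict (\<lambda>j. X j \<omega>) {1..n} \<in> B \<and>
      (\<forall>k\<in>{1..n}. T k \<omega> = s k) \<and> T (Suc n) \<omega> = i \<and> ?f \<omega> \<in> E}"
    by (auto simp: AX_def AT_def)
  ultimately show ?thesis
    using E unfolding N1[OF E]
    by (simp add: c_def AX_def AT_def emeasure_distr vimage_def Int_def conj_ac)
qed

section \<open>Uniqueness for the affine fixed-point equation\<close>

text \<open>Orthants in finitely many coordinates are closed under intersection and make every
  coordinate measurable, so they generate the product sigma-algebra.\<close>

lemma pm_space_measure_eqI:
  fixes N1 N2 :: "('x \<Rightarrow> real) measure"
  assumes sets: "sets N1 = sets pm_space" "sets N2 = sets pm_space" and fin: "finite_measure N1"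
    and eq: "\<And>J a. finite J \<Longrightarrow> emeasure N1 {v. \<forall>l\<in>J. v l \<le> a l} = emeasure N2 {v. \<forall>l\<in>J. v l \<le> a l}"
  shows "N1 = N2"
proof -
  let ?E = "{{v. \<forall>l\<in>J. v l \<le> a l} | (J :: 'x set) (a :: 'x \<Rightarrow> real). finite J}"
  have [measurable]: "{v. \<forall>l\<in>J. v l \<le> a l} \<in> sets pm_space" if "finite J" for J and a :: "'x \<Rightarrow> real"
  proof -
    have "{v \<in> space pm_space. \<forall>l\<in>J. v l \<le> a l} \<in> sets pm_space"
      using that by measurable
    then show ?thesis by (simp add: space_PiM)
  qed
  have id: "(\<lambda>v. v) \<in> measurable (sigma UNIV ?E) (pm_space :: ('x \<Rightarrow> real) measure)"
  proof (rule measurable_PiM_single')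
    show "(\<lambda>v. v l) \<in> borel_measurable (sigma UNIV ?E)" for l
      unfolding borel_measurable_iff_le
    proof
      fix b :: real
      have "{v::'x \<Rightarrow> real. v l \<le> b} \<in> ?E"
        by (intro CollectI exI[of _ "{l}"] exI[of _ "\<lambda>_. b"]) auto
      then show "{v \<in> space (sigma UNIV ?E). v l \<le> b} \<in> sets (sigma UNIV ?E)"
        by (simp add: space_measure_of sets_measure_of)
    qed
  qed auto
  have "UNIV \<in> sets (pm_space :: ('x \<Rightarrow> real) measure)"
    using sets.top[of "pm_space :: ('x \<Rightarrow> real) measure"] by (simp add: space_PiM)
  then have "sigma_sets UNIV ?E \<subseteq> sets pm_space"
    by (intro sets.sigma_sets_subset') auto
  moreover have "A \<in> sigma_sets UNIV ?E" if "A \<in> sets pm_space" for A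
    using measurable_sets[OF id that] by (simp add: space_measure_of sets_measure_of)
  ultimately have *: "sets pm_space = sigma_sets UNIV ?E"
    by blast
  show ?thesis
  proof (rule measure_eqI_generator_eq[where E = ?E and \<Omega> = UNIV and A = "\<lambda>_. UNIV"])
    show "Int_stable ?E"
    proof (rule Int_stableI)
      fix s t assume "s \<in> ?E" "t \<in> ?E"
      then obtain J a J' a' where st: "s = {v. \<forall>l\<in>J. v l \<le> a l}" "t = {v. \<forall>l\<in>J'. v l \<le> a' l}"
        "finite J" "finite J'" by blast
      \<comment> \<open>On coordinates in both sets the two upper bounds combine to their
        minimum.\<close>
      define d where "d l = (if l \<in> J then if l \<in> J' then min (a l) (a' l) else a l else a' l)" for l
      have "s \<inter> t = {v. \<forall>l\<in>J \<union> J'. v l \<le> d l}"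
      proof (intro set_eqI iffI)
        fix v assume "v \<in> s \<inter> t"
        then show "v \<in> {v. \<forall>l\<in>J \<union> J'. v l \<le> d l}"
          by (auto simp: st d_def)
      next
        fix v assume v: "v \<in> {v. \<forall>l\<in>J \<union> J'. v l \<le> d l}"
        have "v l \<le> a l" if "l \<in> J" for l
          using v that by (cases "l \<in> J'") (auto simp: d_def dest!: bspec[of _ _ l])
        moreover have "v l \<le> a' l" if "l \<in> J'" for l
          using v that by (cases "l \<in> J") (auto simp: d_def dest!: bspec[of _ _ l])
        ultimately show "v \<in> s \<inter> t"
          by (simp add: st)
      qed
      then show "s \<inter> t \<in> ?E"
        using st(3,4) by (intro CollectI exI[of _ "J \<union> J'"] exI[of _ d]) auto
    qed
    have "(UNIV :: ('x \<Rightarrow> real) set) \<in> ?E"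
      by (intro CollectI exI[of _ "{}"] exI[of _ "\<lambda>_. 0"]) auto
    then show "range (\<lambda>_::nat. UNIV) \<subseteq> ?E" by auto
    show "emeasure N1 V = emeasure N2 V" if "V \<in> ?E" for V
      using that by (auto intro: eq)
    show "sets N1 = sigma_sets UNIV ?E" "sets N2 = sigma_sets UNIV ?E"
      using sets * by simp_all
    show "emeasure N1 UNIV \<noteq> \<infinity>"
      using fin by (simp add: finite_measure.emeasure_finite)
  qed simp_all
qed

text \<open>The test functions \<open>max 0 (1 - k * (\<Sum>l\<in>J. max 0 (v l - a l)))\<close> decrease to the
  indicator of an orthant as \<open>k\<close> grows, so bounded Lipschitz functions determine the law.\<close>

lemma pm_space_measure_eqI_lipschitz:
  fixes N1 N2 :: "('x \<Rightarrow> real) measure"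
  assumes sets: "sets N1 = sets pm_space" "sets N2 = sets pm_space"
    and prob: "prob_space N1" "prob_space N2"
    and eq: "\<And>J c f. finite J \<Longrightarrow> 0 \<le> c \<Longrightarrow> f \<in> borel_measurable pm_space \<Longrightarrow> (\<And>v. f v \<in> {0..1}) \<Longrightarrow>
      (\<And>v w. \<bar>f v - f w\<bar> \<le> c * (\<Sum>l\<in>J. \<bar>v l - w l\<bar>)) \<Longrightarrow> integral\<^sup>L N1 f = integral\<^sup>L N2 f"
  shows "N1 = N2"
proof (rule pm_space_measure_eqI[OF sets])
  show "finite_measure N1"
    using prob(1) by (simp add: prob_space_def)
  fix J :: "'x set" and a :: "'x \<Rightarrow> real" assume J: "finite J"
  define h where "h v = (\<Sum>l\<in>J. max 0 (v l - a l))" for v :: "'x \<Rightarrow> real"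
  define f where "f k v = max 0 (1 - real k * h v)" for k v
  have h_nonneg: "0 \<le> h v" for v
    by (auto simp: h_def intro: sum_nonneg)
  have [measurable]: "h \<in> borel_measurable pm_space"
    unfolding h_def by measurable
  have f_meas [measurable]: "f k \<in> borel_measurable pm_space" for k
    unfolding f_def by measurable
  have f_range: "f k v \<in> {0..1}" for k v
    using h_nonneg[of v] by (auto simp: f_def)
  have f_lip: "\<bar>f k v - f k w\<bar> \<le> real k * (\<Sum>l\<in>J. \<bar>v l - w l\<bar>)" for k v w
  proof -
    have "\<bar>h v - h w\<bar> \<le> (\<Sum>l\<in>J. \<bar>max 0 (v l - a l) - max 0 (w l - a l)\<bar>)"
      unfolding h_def sum_subtractf[symmetric] by (rule sum_abs)
    also have "\<dots> \<le> (\<Sum>l\<in>J. \<bar>v l - w l\<bar>)"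
      by (intro sum_mono) auto
    finally have "real k * \<bar>h v - h w\<bar> \<le> real k * (\<Sum>l\<in>J. \<bar>v l - w l\<bar>)"
      by (intro mult_left_mono) auto
    moreover have "\<bar>f k v - f k w\<bar> \<le> \<bar>real k * h v - real k * h w\<bar>"
      unfolding f_def by (auto simp: max_def)
    ultimately show ?thesis
      by (simp add: right_diff_distrib[symmetric] abs_mult)
  qed
  have int_eq: "integral\<^sup>L N1 (f k) = integral\<^sup>L N2 (f k)" for k
    by (rule eq[OF J _ f_meas f_range f_lip]) simp
  let ?S = "{v. \<forall>l\<in>J. v l \<le> a l}"
  have S: "?S \<in> sets pm_space"
  proof -
    have "{v \<in> space pm_space. \<forall>l\<in>J. v l \<le> a l} \<in> sets pm_space"
      using J by measurable
    then show ?thesis by (simp add: space_PiM)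
  qed
  have lim: "(\<lambda>k. f k v) \<longlonglongrightarrow> indicator ?S v" for v
  proof (cases "v \<in> ?S")
    case True
    then have "h v = 0" by (auto simp: h_def max_def intro!: sum.neutral)
    then show ?thesis using True by (simp add: f_def)
  next
    case False
    then obtain l where "l \<in> J" "v l > a l" by auto
    then have "0 < h v"
      unfolding h_def using J by (intro sum_pos2[of J l]) auto
    then obtain K where K: "1 < real K * h v"
      using reals_Archimedean3 by blast
    have "f k v = 0" if "k \<ge> K" for k
    proof -
      have "real K * h v \<le> real k * h v"
        using that \<open>0 < h v\<close> by (intro mult_right_mono) auto
      then show ?thesis using K by (simp add: f_def)
    qed
    then have "\<forall>\<^sub>F k in sequentially. f k v = indicator ?S v"
      using False by (auto simp: eventually_sequentially)
    then show ?thesis by (rule tendsto_eventually)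
  qed
  have "(\<lambda>k. integral\<^sup>L N (f k)) \<longlonglongrightarrow> measure N ?S" if "prob_space N" "sets N = sets pm_space" for N
  proof -
    interpret prob_space N by fact
    have [measurable_cong]: "sets N = sets pm_space" by fact
    have "(\<lambda>k. integral\<^sup>L N (f k)) \<longlonglongrightarrow> integral\<^sup>L N (indicator ?S)"
    proof (rule integral_dominated_convergence[where w = "\<lambda>_. 1"])
      show "AE x in N. norm (f k x) \<le> 1" for k
        using f_range[of k] by (auto simp: abs_le_iff)
    qed (use S lim in auto)
    then show ?thesis
      using S that(2) by (simp add: sets_eq_imp_space_eq[OF that(2)] space_PiM)
  qed
  from this[OF prob(1) sets(1)] this[OF prob(2) sets(2)]
  have "measure N1 ?S = measure N2 ?S"
    unfolding int_eq by (rule LIMSEQ_unique)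
  then show "emeasure N1 ?S = emeasure N2 ?S"
    using prob by (simp add: prob_space_def finite_measure.emeasure_eq_measure)
qed

lemma measurable_affine_combination:
  "(\<lambda>((x, \<eta>), \<nu>'). \<lambda>l. x * \<eta> l + (1 - x) * \<nu>' l) \<in>
    measurable ((borel \<Otimes>\<^sub>M pm_space) \<Otimes>\<^sub>M pm_space) (pm_space :: ('x \<Rightarrow> real) measure)"
  unfolding case_prod_beta
proof (rule measurable_PiM_single')
  show "(\<lambda>p. fst (fst p) * snd (fst p) l + (1 - fst (fst p)) * snd p l)
      \<in> borel_measurable ((borel \<Otimes>\<^sub>M pm_space) \<Otimes>\<^sub>M pm_space)" for l :: 'x
    by measurable
qed auto

text \<open>The argument works by duality: test functions are pulled back by the averaging
  \<open>U\<close>, which preserves their integrals against either fixed point and keeps their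
  values in [0,1].\<close>

lemma affine_fixpoint_unique:
  fixes K :: "(real \<times> ('x \<Rightarrow> real)) measure" and N1 N2 :: "('x \<Rightarrow> real) measure"
  assumes K: "prob_space K" "sets K = sets (borel \<Otimes>\<^sub>M pm_space)"
    and x_range: "AE p in K. fst p \<in> {0..1}" and x_pos: "\<not> (AE p in K. fst p = 0)"
    and N: "\<And>N. N \<in> {N1, N2} \<Longrightarrow> prob_space N \<and> sets N = sets pm_space \<and> (AE v in N. \<forall>l. v l \<in> {0..1}) \<and>
      N = distr (K \<Otimes>\<^sub>M N) pm_space (\<lambda>((x, \<eta>), \<nu>'). \<lambda>l. x * \<eta> l + (1 - x) * \<nu>' l)"
  shows "N1 = N2"
proof -
  interpret K: prob_space K by fact
  note K(2) [measurable_cong]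
  define \<rho> where "\<rho> = (\<integral>p. 1 - fst p \<partial>K)"
  have int_fst: "integrable K (\<lambda>p. 1 - fst p)"
    using x_range by (intro K.integrable_const_bound[where B = 1]) auto
  have "0 \<le> \<rho>"
    unfolding \<rho>_def using x_range by (intro integral_nonneg_AE) auto
  \<comment> \<open>A nonnegative variable with mean 0 vanishes almost surely, which
    \<open>x_pos\<close> excludes; hence the mean of x is positive.\<close>
  have "\<rho> < 1"
  proof -
    have int': "integrable K fst"
      using x_range by (intro K.integrable_const_bound[where B = 1]) auto
    have "(\<integral>p. fst p \<partial>K) \<noteq> 0"
      using integral_nonneg_eq_0_iff_AE[OF int'] x_range x_pos by (auto elim: eventually_mono)
    moreover have "0 \<le> (\<integral>p. fst p \<partial>K)"
      using x_range by (intro integral_nonneg_AE) auto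
    moreover have "\<rho> = 1 - (\<integral>p. fst p \<partial>K)"
      unfolding \<rho>_def using int' K.prob_space by simp
    ultimately show ?thesis by linarith
  qed
  define comb :: "(real \<times> ('x \<Rightarrow> real)) \<times> ('x \<Rightarrow> real) \<Rightarrow> 'x \<Rightarrow> real"
    where "comb = (\<lambda>((x, \<eta>), \<nu>'). \<lambda>l. x * \<eta> l + (1 - x) * \<nu>' l)"
  have comb [measurable]: "comb \<in> measurable ((borel \<Otimes>\<^sub>M pm_space) \<Otimes>\<^sub>M pm_space) pm_space"
    unfolding comb_def by (rule measurable_affine_combination)
  define U where "U f v = (\<integral>p. f (comb (p, v)) \<partial>K)" for f :: "('x \<Rightarrow> real) \<Rightarrow> real" and v
  have U_meas [measurable]: "U f \<in> borel_measurable pm_space" if [measurable]: "f \<in> borel_measurable pm_space" for f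
    unfolding U_def by measurable
  have U_int: "integrable K (\<lambda>p. f (comb (p, v)))"
    if [measurable]: "f \<in> borel_measurable pm_space" and "\<And>v. f v \<in> {0..1}"
      for f :: "('x \<Rightarrow> real) \<Rightarrow> real" and v
    using that(2) by (intro K.integrable_const_bound[where B = 1]) (auto simp: abs_le_iff space_PiM, measurable)
  have U_integral: "integral\<^sup>L N f = integral\<^sup>L N (U f)"
    if N': "N \<in> {N1, N2}" and [measurable]: "f \<in> borel_measurable pm_space" and f: "\<And>v. f v \<in> {0..1}"
      for N and f :: "('x \<Rightarrow> real) \<Rightarrow> real"
  proof -
    interpret N: prob_space N using N[OF N'] by simp
    have [measurable_cong]: "sets N = sets pm_space" using N[OF N'] by simp
    interpret KN: pair_prob_space K N ..
    have int: "integrable (K \<Otimes>\<^sub>M N) (\<lambda>p. f (comb p))"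
      using f by (intro KN.integrable_const_bound[where B = 1]) (auto simp: abs_le_iff)
    have "integral\<^sup>L N f = integral\<^sup>L (distr (K \<Otimes>\<^sub>M N) pm_space comb) f"
      using N[OF N'] unfolding comb_def by simp
    also have "\<dots> = (\<integral>p. f (comb p) \<partial>(K \<Otimes>\<^sub>M N))"
      by (rule integral_distr) auto
    also have "\<dots> = (\<integral>v. \<integral>p. f (comb (p, v)) \<partial>K \<partial>N)"
      using KN.integral_snd[of "\<lambda>p v. f (comb (p, v))"] int by (simp add: case_prod_beta')
    finally show ?thesis by (simp add: U_def[abs_def])
  qed
  show ?thesis
  proof (rule pm_space_measure_eqI_lipschitz)
    fix J :: "'x set" and c :: real and f :: "('x \<Rightarrow> real) \<Rightarrow> real"
    assume J: "finite J" and hyps: "0 \<le> c" "f \<in> borel_measurable pm_space" "\<And>v. f v \<in> {0..1}"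
      "\<And>v w. \<bar>f v - f w\<bar> \<le> c * (\<Sum>l\<in>J. \<bar>v l - w l\<bar>)"
    \<comment> \<open>The induction varies f and c, since its step applies the hypothesis to
      \<open>U f\<close> with the constant \<open>c * \<rho>\<close>. The factor |J| is the
      l1-diameter of the unit cube over J.\<close>
    have "\<bar>integral\<^sup>L N1 f - integral\<^sup>L N2 f\<bar> \<le> c * \<rho> ^ n * real (card J)" for n
      using hyps
    proof (induction n arbitrary: c f)
      case (0 c f)
      note 0(2) [measurable]
      interpret N1: prob_space N1 using N[of N1] by simp
      interpret N2: prob_space N2 using N[of N2] by simp
      have [measurable_cong]: "sets N1 = sets pm_space" "sets N2 = sets pm_space" using N by auto
      \<comment> \<open>The two integrals are compared through the value of f at a single w, which
        is then averaged over \<open>N2\<close>; both laws are carried by [0,1]-valued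
        functions.\<close>
      have dev: "\<bar>integral\<^sup>L N1 f - f w\<bar> \<le> c * real (card J)" if w: "\<forall>l. w l \<in> {0..1}" for w
      proof -
        have "integrable N1 f"
          using 0(3) by (intro N1.integrable_const_bound[where B = 1]) (auto simp: abs_le_iff)
        then have "integral\<^sup>L N1 f - f w = (\<integral>v. f v - f w \<partial>N1)"
          by (simp add: N1.prob_space)
        also have "\<bar>\<dots>\<bar> \<le> (\<integral>v. \<bar>f v - f w\<bar> \<partial>N1)"
          using integral_norm_bound[of N1 "\<lambda>v. f v - f w"] by simp
        also have "\<dots> \<le> (\<integral>v. c * real (card J) \<partial>N1)"
        proof (rule integral_mono_AE)
          have "\<bar>f v - f w\<bar> \<le> c * real (card J)" if "\<forall>l. v l \<in> {0..1}" for v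
          proof -
            have "(\<Sum>l\<in>J. \<bar>v l - w l\<bar>) \<le> (\<Sum>l\<in>J. 1)"
              using w that by (intro sum_mono) (simp add: abs_le_iff algebra_simps add_increasing2 add_mono)
            then show ?thesis
              using 0(4)[of v w] mult_left_mono[OF _ 0(1)] by fastforce
          qed
          then show "AE v in N1. \<bar>f v - f w\<bar> \<le> c * real (card J)"
            using N[of N1] by (auto elim: eventually_mono)
        qed (use \<open>integrable N1 f\<close> in auto)
        finally show ?thesis by (simp add: N1.prob_space)
      qed
      have int2: "integrable N2 f"
        using 0(3) by (intro N2.integrable_const_bound[where B = 1]) (auto simp: abs_le_iff)
      then have "integral\<^sup>L N1 f - integral\<^sup>L N2 f = (\<integral>w. integral\<^sup>L N1 f - f w \<partial>N2)"
        by (simp add: N2.prob_space)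
      also have "\<bar>\<dots>\<bar> \<le> (\<integral>w. \<bar>integral\<^sup>L N1 f - f w\<bar> \<partial>N2)"
        using integral_norm_bound[of N2 "\<lambda>w. integral\<^sup>L N1 f - f w"] by simp
      also have "\<dots> \<le> (\<integral>w. c * real (card J) \<partial>N2)"
        using int2 N[of N2] dev by (intro integral_mono_AE) (auto elim: eventually_mono)
      finally show ?case by (simp add: N2.prob_space)
    next
      case (Suc n c f)
      note Suc.prems(2) [measurable]
      have U_lip: "\<bar>U f v - U f w\<bar> \<le> (c * \<rho>) * (\<Sum>l\<in>J. \<bar>v l - w l\<bar>)" for v w
      proof -
        have "U f v - U f w = (\<integral>p. f (comb (p, v)) - f (comb (p, w)) \<partial>K)"
          unfolding U_def using U_int[OF Suc.prems(2,3)] by simp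
        also have "\<bar>\<dots>\<bar> \<le> (\<integral>p. \<bar>f (comb (p, v)) - f (comb (p, w))\<bar> \<partial>K)"
          using integral_norm_bound[of K "\<lambda>p. f (comb (p, v)) - f (comb (p, w))"] by simp
        also have "\<dots> \<le> (\<integral>p. (1 - fst p) * (c * (\<Sum>l\<in>J. \<bar>v l - w l\<bar>)) \<partial>K)"
        proof (rule integral_mono_AE)
          have "\<bar>f (comb (p, v)) - f (comb (p, w))\<bar> \<le> (1 - fst p) * (c * (\<Sum>l\<in>J. \<bar>v l - w l\<bar>))"
            if "fst p \<in> {0..1}" for p
          proof -
            \<comment> \<open>The same eta occurs in both combinations and cancels, which leaves the
              factor 1 - x.\<close>
            have "(\<Sum>l\<in>J. \<bar>comb (p, v) l - comb (p, w) l\<bar>) = (1 - fst p) * (\<Sum>l\<in>J. \<bar>v l - w l\<bar>)"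
              using that by (simp add: comb_def case_prod_beta sum_distrib_left abs_mult right_diff_distrib[symmetric])
            then show ?thesis
              using Suc.prems(4)[of "comb (p, v)" "comb (p, w)"] by (simp add: mult_ac)
          qed
          then show "AE p in K. \<bar>f (comb (p, v)) - f (comb (p, w))\<bar> \<le> (1 - fst p) * (c * (\<Sum>l\<in>J. \<bar>v l - w l\<bar>))"
            using x_range by (auto elim: eventually_mono)
        qed (use U_int[OF Suc.prems(2,3)] int_fst in auto)
        also have "\<dots> = \<rho> * (c * (\<Sum>l\<in>J. \<bar>v l - w l\<bar>))"
          unfolding \<rho>_def by (rule integral_mult_left_zero)
        finally show ?thesis by (simp add: mult_ac)
      qed
      have "U f v \<in> {0..1}" for v
      proof -
        have "0 \<le> U f v"
          unfolding U_def using Suc.prems(3) by (intro integral_nonneg_AE) auto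
        moreover have "U f v \<le> (\<integral>p. 1 \<partial>K)"
          unfolding U_def using Suc.prems(3) U_int[OF Suc.prems(2,3)] by (intro integral_mono) auto
        ultimately show ?thesis by (simp add: K.prob_space)
      qed
      then have "\<bar>integral\<^sup>L N1 (U f) - integral\<^sup>L N2 (U f)\<bar> \<le> (c * \<rho>) * \<rho> ^ n * real (card J)"
        using Suc.prems(1,2) \<open>0 \<le> \<rho>\<close> U_lip by (intro Suc.IH) auto
      then show ?case
        using U_integral[of N1 f] U_integral[of N2 f] Suc.prems(2,3) by (simp add: mult_ac)
    qed
    moreover have "(\<lambda>n. c * \<rho> ^ n * real (card J)) \<longlonglongrightarrow> c * 0 * real (card J)"
      using \<open>0 \<le> \<rho>\<close> \<open>\<rho> < 1\<close> by (intro tendsto_intros LIMSEQ_power_zero) auto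
    ultimately have "\<bar>integral\<^sup>L N1 f - integral\<^sup>L N2 f\<bar> \<le> c * 0 * real (card J)"
      by (intro LIMSEQ_le_const) auto
    then show "integral\<^sup>L N1 f = integral\<^sup>L N2 f" by simp
  qed (use N[of N1] N[of N2] in auto)
qed

section \<open>The first cycle of a recurrent chain\<close>

lemma markov_chain_path_extend:
  fixes T :: "nat \<Rightarrow> 'a \<Rightarrow> 'x"
  assumes M: "prob_space M" and T: "markov_chain M Q \<mu> T" and m: "m \<ge> 1"
  shows "emeasure M {\<omega> \<in> space M. \<forall>k\<in>{1..Suc m}. T k \<omega> = (s(Suc m := y)) k} =
    emeasure M {\<omega> \<in> space M. \<forall>k\<in>{1..m}. T k \<omega> = s k} * ennreal (pmf (Q (s m)) y)"
proof -
  have "(\<Prod>k\<in>{1..<Suc m}. pmf (Q ((s(Suc m := y)) k)) ((s(Suc m := y)) (Suc k))) =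
      (\<Prod>k\<in>{1..<m}. pmf (Q (s k)) (s (Suc k))) * pmf (Q (s m)) y"
  proof -
    have "{1..<Suc m} = insert m {1..<m}" using m by auto
    moreover have "(\<Prod>k\<in>{1..<m}. pmf (Q ((s(Suc m := y)) k)) ((s(Suc m := y)) (Suc k))) =
      (\<Prod>k\<in>{1..<m}. pmf (Q (s k)) (s (Suc k)))"
      by (intro prod.cong) auto
    ultimately show ?thesis by simp
  qed
  moreover have "(s(Suc m := y)) 1 = s 1" using m by simp
  ultimately show ?thesis
    using m by (simp only: markov_chain_path[OF M T m] markov_chain_path[OF M T, of "Suc m"])
      (simp add: ennreal_mult[symmetric] prod_nonneg mult.assoc)
qed

lemma path_upd_iff:
  fixes s :: "nat \<Rightarrow> 'x"
  shows "(\<forall>k\<in>{1..Suc m}. f k = (s(Suc m := y)) k) \<longleftrightarrow>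
    (\<forall>k\<in>{1..m}. f k = s k) \<and> f (Suc m) = y"
proof -
  have "{1..Suc m} = insert (Suc m) {1..m}" by auto
  moreover have "(\<forall>k\<in>{1..m}. f k = (s(Suc m := y)) k) \<longleftrightarrow> (\<forall>k\<in>{1..m}. f k = s k)"
    by (intro ball_cong) auto
  ultimately show ?thesis by auto
qed

text \<open>\<open>first_passage\<close> peels off the first step, so the induction on the length of
  the excursion lets the prefix grow: the state y at time m + 1 is appended to s and the hypothesis
  is applied to the longer prefix.\<close>

lemma emeasure_first_passage:
  fixes T :: "nat \<Rightarrow> 'a \<Rightarrow> 'x::countable"
  assumes M: "prob_space M" and T: "markov_chain M Q \<mu> T" and m: "m \<ge> 1"
  shows "emeasure M {\<omega> \<in> space M. (\<forall>k\<in>{1..m}. T k \<omega> = s k) \<and>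
      (\<forall>k\<in>{Suc m..<Suc (m + n)}. T k \<omega> \<noteq> i) \<and> T (Suc (m + n)) \<omega> = i} =
    emeasure M {\<omega> \<in> space M. \<forall>k\<in>{1..m}. T k \<omega> = s k} * first_passage Q i (Suc n) (s m)"
  using m
proof (induction n arbitrary: m s)
  case 0
  have "{\<omega> \<in> space M. (\<forall>k\<in>{1..m}. T k \<omega> = s k) \<and>
      (\<forall>k\<in>{Suc m..<Suc (m + 0)}. T k \<omega> \<noteq> i) \<and> T (Suc (m + 0)) \<omega> = i} =
    {\<omega> \<in> space M. \<forall>k\<in>{1..Suc m}. T k \<omega> = (s(Suc m := i)) k}"
    unfolding path_upd_iff by simp
  then show ?case
    by (simp only: markov_chain_path_extend[OF M T 0] first_passage.simps)
next
  case (Suc n m s)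
  have meas [measurable]: "T j \<in> measurable M (count_space UNIV)" if "j \<ge> 1" for j
    using that T by (auto intro: markov_chain_measurable)
  let ?E = "\<lambda>y. {\<omega> \<in> space M. (\<forall>k\<in>{1..Suc m}. T k \<omega> = (s(Suc m := y)) k) \<and>
      (\<forall>k\<in>{Suc (Suc m)..<Suc (Suc m + n)}. T k \<omega> \<noteq> i) \<and> T (Suc (Suc m + n)) \<omega> = i}"
  \<comment> \<open>The empty set for y = i mirrors the value 0 in the recursion, which excludes
    hitting i too early.\<close>
  let ?F = "\<lambda>y. if y = i then {} else ?E y"
  have E: "?E y \<in> sets M" for y
    by measurable
  let ?L = "{\<omega> \<in> space M. (\<forall>k\<in>{1..m}. T k \<omega> = s k) \<and>
      (\<forall>k\<in>{Suc m..<Suc (m + Suc n)}. T k \<omega> \<noteq> i) \<and> T (Suc (m + Suc n)) \<omega> = i}"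
  have L: "?L = (\<Union>y. ?F y)"
  proof -
    have "{Suc m..<Suc (m + Suc n)} = insert (Suc m) {Suc (Suc m)..<Suc (Suc m + n)}"
      by auto
    then show ?thesis
      unfolding path_upd_iff by (auto split: if_splits)
  qed
  have "emeasure M ?L = (\<integral>\<^sup>+ y. emeasure M (?F y) \<partial>count_space UNIV)"
    unfolding L
  proof (rule emeasure_UN_countable)
    show "disjoint_family_on ?F UNIV"
      unfolding path_upd_iff by (auto simp: disjoint_family_on_def)
  qed (use E in auto)
  also have "\<dots> = (\<integral>\<^sup>+ y. emeasure M {\<omega> \<in> space M. \<forall>k\<in>{1..m}. T k \<omega> = s k} *
      (ennreal (pmf (Q (s m)) y) * (if y = i then 0 else first_passage Q i (Suc n) y)) \<partial>count_space UNIV)"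
  proof (rule nn_integral_cong)
    fix y
    show "emeasure M (?F y) = emeasure M {\<omega> \<in> space M. \<forall>k\<in>{1..m}. T k \<omega> = s k} *
      (ennreal (pmf (Q (s m)) y) * (if y = i then 0 else first_passage Q i (Suc n) y))"
      using Suc.IH[of "Suc m" "s(Suc m := y)"] markov_chain_path_extend[OF M T Suc.prems, of s y]
      by (simp add: mult.assoc)
  qed
  also have "\<dots> = emeasure M {\<omega> \<in> space M. \<forall>k\<in>{1..m}. T k \<omega> = s k} *
      (\<integral>\<^sup>+ y. (ennreal (pmf (Q (s m)) y) * (if y = i then 0 else first_passage Q i (Suc n) y)) \<partial>count_space UNIV)"
    by (rule nn_integral_cmult) auto
  finally show ?case
    by (simp add: nn_integral_measure_pmf)
qed

text \<open>First returns at different times are disjoint events. By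
  \<open>emeasure_first_passage\<close>, with a prefix consisting of i alone, their probabilities
  are the terms of the series that recurrence sets equal to 1.\<close>

lemma recurrent_return_AE:
  fixes S :: "nat \<Rightarrow> 'a \<Rightarrow> 'x::countable"
  assumes M: "prob_space M" and S: "markov_chain M Q (return_pmf i) S" and i: "recurrent_state Q i"
  shows "AE \<omega> in M. \<exists>j>1. S j \<omega> = i"
proof -
  interpret prob_space M by fact
  have meas [measurable]: "S j \<in> measurable M (count_space UNIV)" if "j \<ge> 1" for j
    using that S by (auto intro: markov_chain_measurable)
  \<comment> \<open>Time starts at 1, so a passage of n + 1 steps ends at index n + 2. The interval
    \<open>{1..1}\<close> keeps the shape of a prefix of length 1.\<close>
  define R where "R n = {\<omega> \<in> space M. (\<forall>k\<in>{1..1}. S k \<omega> = (\<lambda>_. i) k) \<and>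
      (\<forall>k\<in>{Suc 1..<Suc (1 + n)}. S k \<omega> \<noteq> i) \<and> S (Suc (1 + n)) \<omega> = i}" for n
  have [measurable]: "R n \<in> sets M" for n
  proof -
    have [measurable]: "Measurable.pred M (\<lambda>\<omega>. \<forall>k\<in>{Suc 1..<Suc (1 + n)}. S k \<omega> \<noteq> i)"
      by measurable
    show ?thesis unfolding R_def by measurable
  qed
  have "emeasure M {\<omega> \<in> space M. \<forall>k\<in>{1..1}. S k \<omega> = (\<lambda>_. i) k} = 1"
    by (subst markov_chain_path[OF M S]) simp_all
  then have R: "emeasure M (R n) = first_passage Q i (Suc n) i" for n
    unfolding R_def emeasure_first_passage[OF M S order.refl] by simp
  have "disjoint_family R"
  proof -
    have "R n \<inter> R n' = {}" if "n < n'" for n n'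
      using that by (auto simp: R_def)
    then show ?thesis
      unfolding disjoint_family_on_def by (metis Int_commute linorder_less_linear)
  qed
  then have "emeasure M (\<Union>n. R n) = (\<Sum>n. first_passage Q i (Suc n) i)"
    by (subst suminf_emeasure[symmetric]) (auto simp: R simp del: first_passage.simps)
  then have "emeasure M (\<Union>n. R n) = 1"
    using i by (simp add: recurrent_state_def)
  then have "AE \<omega> in M. \<omega> \<in> (\<Union>n. R n)"
    by (intro AE_prob_1) (simp add: measure_def)
  then show ?thesis
  proof (rule eventually_mono)
    fix \<omega> assume "\<omega> \<in> (\<Union>n. R n)"
    then obtain n where "S (Suc (1 + n)) \<omega> = i" by (auto simp: R_def)
    then show "\<exists>j>1. S j \<omega> = i" by (intro exI[of _ "Suc (1 + n)"]) auto
  qed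
qed

section \<open>Return time and measurability of the cycle functionals\<close>

lemma return_time_eq_Suc:
  assumes "n \<ge> 1" "\<forall>k\<in>{2..n}. S k \<omega> \<noteq> i" "S (Suc n) \<omega> = i"
  shows "return_time i S \<omega> = Suc n"
  unfolding return_time_def
proof (rule Least_equality)
  fix j assume "1 < j \<and> S j \<omega> = i"
  then show "Suc n \<le> j"
    using assms(2) by (force simp: not_less_eq_eq[symmetric])
qed (use assms in auto)

lemma return_time_props:
  assumes "\<exists>j>1. S j \<omega> = i"
  shows "return_time i S \<omega> > 1" "S (return_time i S \<omega>) \<omega> = i"
    "\<And>k. 1 < k \<Longrightarrow> k < return_time i S \<omega> \<Longrightarrow> S k \<omega> \<noteq> i"
proof -
  show "return_time i S \<omega> > 1" "S (return_time i S \<omega>) \<omega> = i"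
    using LeastI_ex[OF assms] by (auto simp: return_time_def)
  fix k assume k: "1 < k" "k < return_time i S \<omega>"
  show "S k \<omega> \<noteq> i"
    using not_less_Least[OF k(2)[unfolded return_time_def]] k(1) by simp
qed

lemma measurable_return_time:
  assumes "\<And>j. j \<ge> 1 \<Longrightarrow> S j \<in> measurable M (count_space UNIV)"
  shows "return_time i S \<in> measurable M (count_space UNIV)"
proof -
  have "(\<lambda>\<omega>. 1 < j \<and> S j \<omega> = i) \<in> measurable M (count_space UNIV)" for j
  \<comment> \<open>For j <= 1 the predicate is constantly false; this disposes of index 0, at which
    S need not be measurable.\<close>
  proof (cases "1 < j")
    case True
    then have "S j \<in> measurable M (count_space UNIV)"
      using assms by simp
    then show ?thesis
      by measurable
  qed simp
  then show ?thesis
    unfolding return_time_def[abs_def] by (rule measurable_Least)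
qed

context
  fixes M :: "'a measure" and X :: "nat \<Rightarrow> 'a \<Rightarrow> real" and S :: "nat \<Rightarrow> 'a \<Rightarrow> 'x::countable" and i :: 'x
  assumes X_meas: "\<And>j. j \<ge> 1 \<Longrightarrow> X j \<in> borel_measurable M"
    and S_meas: "\<And>j. j \<ge> 1 \<Longrightarrow> S j \<in> measurable M (count_space UNIV)"
begin

lemma measurable_ram_weight: "j \<ge> 1 \<Longrightarrow> ram_weight X j \<in> borel_measurable M"
  unfolding ram_weight_def[abs_def] using X_meas by (intro borel_measurable_times borel_measurable_prod) auto

lemma measurable_indicator_state:
  "j \<ge> 1 \<Longrightarrow> (\<lambda>\<omega>. if S j \<omega> = l then 1 else 0 :: real) \<in> borel_measurable M"
  using S_meas[of j] by measurable

text \<open>The number of summands is random but countably valued, so it can be frozen at each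
  n.\<close>

lemma measurable_cycle_mass: "cycle_mass X i S \<in> borel_measurable M"
proof -
  have "(\<lambda>\<omega>. \<Sum>j\<in>{1..<return_time i S \<omega>}. ram_weight X j \<omega>) \<in> borel_measurable M"
  proof (rule measurable_compose_countable[where g = "return_time i S" and
        f = "\<lambda>n \<omega>. \<Sum>j\<in>{1..<n}. ram_weight X j \<omega>"])
    show "(\<lambda>\<omega>. \<Sum>j\<in>{1..<n}. ram_weight X j \<omega>) \<in> borel_measurable M" for n
      by (intro borel_measurable_sum measurable_ram_weight) simp
  qed (rule measurable_return_time[OF S_meas])
  then show ?thesis by (simp add: cycle_mass_def[abs_def])
qed

lemma measurable_cycle_meas: "cycle_meas X i S \<in> measurable M pm_space"
proof (rule measurable_PiM_single')
  fix l
  have "(\<lambda>\<omega>. \<Sum>j\<in>{1..<return_time i S \<omega>}. ram_weight X j \<omega> * (if S j \<omega> = l then 1 else 0)) \<in> borel_measurable M"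
  proof (rule measurable_compose_countable[where g = "return_time i S" and
        f = "\<lambda>n \<omega>. \<Sum>j\<in>{1..<n}. ram_weight X j \<omega> * (if S j \<omega> = l then 1 else 0)"])
    show "(\<lambda>\<omega>. \<Sum>j\<in>{1..<n}. ram_weight X j \<omega> * (if S j \<omega> = l then 1 else 0)) \<in> borel_measurable M" for n
      by (intro borel_measurable_sum borel_measurable_times measurable_ram_weight measurable_indicator_state) simp_all
  qed (rule measurable_return_time[OF S_meas])
  then show "(\<lambda>\<omega>. cycle_meas X i S \<omega> l) \<in> borel_measurable M"
    unfolding cycle_meas_def using measurable_cycle_mass
    by (intro borel_measurable_times borel_measurable_inverse) auto
qed auto

end

text \<open>The pair \<open>(X\<^sup>i, \<eta>\<^sup>i)\<close> as a function of the fractions \<open>x\<close>, on the event that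
  the first cycle has length \<open>n\<close> and traces the path \<open>s\<close>.\<close>

definition cycle_of :: "nat \<Rightarrow> (nat \<Rightarrow> 'x) \<Rightarrow> (nat \<Rightarrow> real) \<Rightarrow> real \<times> ('x \<Rightarrow> real)" where
  "cycle_of n s x = (\<Sum>j\<in>{1..n}. ram_weight (\<lambda>j x. x j) j x,
    \<lambda>l. inverse (\<Sum>j\<in>{1..n}. ram_weight (\<lambda>j x. x j) j x) *
      (\<Sum>j\<in>{1..n}. ram_weight (\<lambda>j x. x j) j x * (if s j = l then 1 else 0)))"

lemma measurable_cycle_of [measurable]:
  "cycle_of n s \<in> measurable (PiM {1..n} (\<lambda>_. borel)) (borel \<Otimes>\<^sub>M pm_space)"
proof -
  have w [measurable]: "ram_weight (\<lambda>j x. x j) j \<in> borel_measurable (PiM {1..n} (\<lambda>_. borel))" if "j \<in> {1..n}" for j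
    unfolding ram_weight_def[abs_def] using that
    by (intro borel_measurable_times borel_measurable_prod borel_measurable_diff measurable_component_singleton) auto
  show ?thesis
    unfolding cycle_of_def[abs_def]
    by (intro measurable_Pair measurable_PiM_single' borel_measurable_times borel_measurable_inverse borel_measurable_sum w) auto
qed

text \<open>With length and path fixed, the only randomness left in the cycle is that of the first n
  fractions, the form that \<open>joint_regeneration\<close> accepts. The return is at n + 1, so the
  cycle occupies the indices 1 to n.\<close>

lemma cycle_eq_cycle_of:
  assumes "return_time i S \<omega> = Suc n" "\<forall>k\<in>{1..n}. S k \<omega> = s k"
  shows "(cycle_mass X i S \<omega>, cycle_meas X i S \<omega>) = cycle_of n s (restrict (\<lambda>j. X j \<omega>) {1..n})"
proof -
  have w: "ram_weight X j \<omega> = ram_weight (\<lambda>j x. x j) j (restrict (\<lambda>j. X j \<omega>) {1..n})" if "j \<in> {1..n}" for j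
    unfolding ram_weight_def using that by (intro arg_cong2[where f = times] prod.cong) auto
  have 1: "cycle_mass X i S \<omega> = (\<Sum>j\<in>{1..n}. ram_weight (\<lambda>j x. x j) j (restrict (\<lambda>j. X j \<omega>) {1..n}))"
    unfolding cycle_mass_def assms(1) atLeastLessThanSuc_atLeastAtMost by (intro sum.cong w) auto
  have 2: "(\<Sum>j\<in>{1..n}. ram_weight X j \<omega> * (if S j \<omega> = l then 1 else 0)) =
      (\<Sum>j\<in>{1..n}. ram_weight (\<lambda>j x. x j) j (restrict (\<lambda>j. X j \<omega>) {1..n}) * (if s j = l then 1 else 0))" for l
    using assms(2) by (intro sum.cong) (auto simp: w simp del: restrict_apply)
  show ?thesis
    unfolding cycle_of_def cycle_meas_def assms(1) atLeastLessThanSuc_atLeastAtMost 1 2 ..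
qed

text \<open>With W the return time, the shift is by W - 1, not W: index 1 of the shifted sequences
  is then time W itself, where the chain is again in i.\<close>

definition nu_after_cycle :: "(nat \<Rightarrow> 'a \<Rightarrow> real) \<Rightarrow> 'x \<Rightarrow> (nat \<Rightarrow> 'a \<Rightarrow> 'x) \<Rightarrow> 'a \<Rightarrow> 'x \<Rightarrow> real" where
  "nu_after_cycle X i S \<omega> = (let n = return_time i S \<omega> - 1 in
    ram_nu (\<lambda>j. X (j + n)) (\<lambda>j. S (j + n)) \<omega>)"

text \<open>This is \<open>ram_nu_split\<close> at n = W - 1. It holds at every outcome, whatever
  value \<open>LEAST\<close> takes on a path that never returns, so the later comparison of laws has
  no exceptional set.\<close>

lemma ram_nu_cycle_decomposition:
  assumes X: "\<And>j. j \<ge> 1 \<Longrightarrow> X j \<omega> \<in> {0..1}"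
  shows "ram_nu X S \<omega> = (\<lambda>l. cycle_mass X i S \<omega> * cycle_meas X i S \<omega> l +
    (1 - cycle_mass X i S \<omega>) * nu_after_cycle X i S \<omega> l)"
proof
  fix l
  define n where "n = return_time i S \<omega> - 1"
  have *: "{1..<return_time i S \<omega>} = {1..n}" by (auto simp: n_def)
  have mass: "cycle_mass X i S \<omega> = (\<Sum>j\<in>{1..n}. ram_weight X j \<omega>)"
    unfolding cycle_mass_def * ..
  have nonneg: "0 \<le> ram_weight X j \<omega>" if "j \<in> {1..n}" for j
    using ram_weight_nonneg[of X \<omega>, OF X] that by simp
  have "cycle_mass X i S \<omega> * cycle_meas X i S \<omega> l =
    (\<Sum>j\<in>{1..n}. ram_weight X j \<omega> * (if S j \<omega> = l then 1 else 0))"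
  \<comment> \<open>With mass 0 the normalisation is the default \<open>inverse 0 = 0\<close>; the
    nonnegative weights of the cycle then all vanish, so both sides are 0.\<close>
  proof (cases "cycle_mass X i S \<omega> = 0")
    case True
    then have "\<forall>j\<in>{1..n}. ram_weight X j \<omega> = 0"
      unfolding mass using nonneg by (subst (asm) sum_nonneg_eq_0_iff) auto
    then show ?thesis using True by simp
  qed (simp add: cycle_meas_def *)
  moreover have "1 - cycle_mass X i S \<omega> = (\<Prod>l\<in>{1..n}. 1 - X l \<omega>)"
    unfolding mass sum_ram_weight by simp
  ultimately show "ram_nu X S \<omega> l = cycle_mass X i S \<omega> * cycle_meas X i S \<omega> l +
    (1 - cycle_mass X i S \<omega>) * nu_after_cycle X i S \<omega> l"
    using ram_nu_split[of X \<omega> S l n, OF X] by (simp add: nu_after_cycle_def n_def[symmetric])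
qed

lemma measurable_ram_nu:
  fixes S :: "nat \<Rightarrow> 'a \<Rightarrow> 'x::countable"
  assumes "\<And>j. j \<ge> 1 \<Longrightarrow> X j \<in> borel_measurable M"
    and "\<And>j. j \<ge> 1 \<Longrightarrow> S j \<in> measurable M (count_space UNIV)"
  shows "ram_nu X S \<in> measurable M pm_space"
  unfolding ram_nu_eq_nu_of[abs_def] using assms
  by (intro measurable_compose[OF _ measurable_nu_of] measurable_Pair measurable_restrict) auto

lemma measurable_nu_after_cycle:
  fixes S :: "nat \<Rightarrow> 'a \<Rightarrow> 'x::countable"
  assumes "\<And>j. j \<ge> 1 \<Longrightarrow> X j \<in> borel_measurable M"
    and "\<And>j. j \<ge> 1 \<Longrightarrow> S j \<in> measurable M (count_space UNIV)"
  shows "nu_after_cycle X i S \<in> measurable M pm_space"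
proof -
  have "(\<lambda>\<omega>. ram_nu (\<lambda>j. X (j + (return_time i S \<omega> - 1))) (\<lambda>j. S (j + (return_time i S \<omega> - 1))) \<omega>) \<in> measurable M pm_space"
  proof (rule measurable_compose_countable[where g = "return_time i S" and
        f = "\<lambda>n. ram_nu (\<lambda>j. X (j + (n - 1))) (\<lambda>j. S (j + (n - 1)))"])
    show "ram_nu (\<lambda>j. X (j + (n - 1))) (\<lambda>j. S (j + (n - 1))) \<in> measurable M pm_space" for n
      using assms by (intro measurable_ram_nu) simp_all
  qed (rule measurable_return_time[OF assms(2)])
  then show ?thesis by (simp add: nu_after_cycle_def[abs_def] Let_def)
qed

text \<open>The strong Markov step. On each path event the probability factors by
  \<open>joint_regeneration\<close>; the factor of the remainder does not depend on the event and
  leaves the sum, and what stays behind is the law of the cycle.\<close>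

lemma cycle_indep_after_cycle:
  fixes S :: "nat \<Rightarrow> 'a \<Rightarrow> 'x::countable" and X :: "nat \<Rightarrow> 'a \<Rightarrow> real"
  assumes M: "prob_space M" and X: "prob_space.indep_vars M (\<lambda>_. borel) X {1..}"
    and ident: "\<forall>j\<ge>1. distr M borel (X j) = distr M borel (X 1)"
    and S: "markov_chain M Q (return_pmf i) S"
    and XS: "indep_rv M frac_seqs (\<lambda>\<omega>. restrict (\<lambda>j. X j \<omega>) {1..})
      state_seqs (\<lambda>\<omega>. restrict (\<lambda>j. S j \<omega>) {1..})"
    and rec: "recurrent_state Q i"
  shows "distr M (borel \<Otimes>\<^sub>M pm_space) (\<lambda>\<omega>. (cycle_mass X i S \<omega>, cycle_meas X i S \<omega>)) \<Otimes>\<^sub>M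
      distr M pm_space (ram_nu X S) =
    distr M ((borel \<Otimes>\<^sub>M pm_space) \<Otimes>\<^sub>M pm_space)
      (\<lambda>\<omega>. ((cycle_mass X i S \<omega>, cycle_meas X i S \<omega>), nu_after_cycle X i S \<omega>))"
    (is "distr M _ ?Y \<Otimes>\<^sub>M _ = distr M _ (\<lambda>\<omega>. (_, ?V \<omega>))")
proof -
  interpret prob_space M by fact
  have X_meas: "X j \<in> borel_measurable M" if "j \<ge> 1" for j
    using X that by (auto simp: indep_vars_def)
  have S_meas: "S j \<in> measurable M (count_space UNIV)" if "j \<ge> 1" for j
    using that S by (auto intro: markov_chain_measurable)
  note [measurable] = X_meas S_meas
  have Y [measurable]: "?Y \<in> measurable M (borel \<Otimes>\<^sub>M pm_space)"
    by (intro measurable_Pair measurable_cycle_mass measurable_cycle_meas X_meas S_meas)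
  have V [measurable]: "?V \<in> measurable M pm_space"
    by (intro measurable_nu_after_cycle X_meas S_meas)
  have nu [measurable]: "ram_nu X S \<in> measurable M pm_space"
    by (intro measurable_ram_nu X_meas S_meas)
  \<comment> \<open>Lengths and paths of a first cycle, with i avoided after time 1; paths are
    extensional so that different indices give disjoint events. The first entry is left free: paths
    not starting at i contribute only null events.\<close>
  define I where "I = (SIGMA n:{1::nat..}. {s \<in> {1..n} \<rightarrow>\<^sub>E UNIV. \<forall>k\<in>{2..n}. s k \<noteq> i})"
  define G where "G p = {\<omega> \<in> space M. (\<forall>k\<in>{1..fst p}. S k \<omega> = snd p k) \<and> S (Suc (fst p)) \<omega> = i}" for p
  have I: "countable I"
    unfolding I_def
    by (intro countable_SIGMA countable_subset[OF _ countable_PiE[of "{1.._}" "\<lambda>_. UNIV"]]) auto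
  have [measurable]: "G p \<in> sets M" for p
    unfolding G_def by measurable
  have W: "return_time i S \<omega> = Suc (fst p)" if "p \<in> I" "\<omega> \<in> G p" for p \<omega>
    using that by (intro return_time_eq_Suc) (auto simp: I_def G_def)
  have disj: "disjoint_family_on G I"
    unfolding disjoint_family_on_def
  proof (intro ballI impI)
    fix p q assume pq: "p \<in> I" "q \<in> I" "p \<noteq> q"
    show "G p \<inter> G q = {}"
    proof (rule ccontr)
      assume "G p \<inter> G q \<noteq> {}"
      then obtain \<omega> where \<omega>: "\<omega> \<in> G p" "\<omega> \<in> G q" by auto
      then have "fst p = fst q"
        using W[OF pq(1) \<omega>(1)] W[OF pq(2) \<omega>(2)] by simp
      moreover have "snd p = snd q"
      proof (rule PiE_ext)
        show "snd p \<in> {1..fst p} \<rightarrow>\<^sub>E UNIV" "snd q \<in> {1..fst p} \<rightarrow>\<^sub>E UNIV"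
          using pq \<open>fst p = fst q\<close> by (auto simp: I_def)
        show "snd p k = snd q k" if "k \<in> {1..fst p}" for k
        proof -
          have "S k \<omega> = snd p k"
            using \<omega>(1) that by (simp add: G_def)
          moreover have "S k \<omega> = snd q k"
            using \<omega>(2) that \<open>fst p = fst q\<close> by (simp add: G_def)
          ultimately show ?thesis by simp
        qed
      qed
      ultimately show False using pq(3) by (simp add: prod_eq_iff)
    qed
  qed
  \<comment> \<open>Recurrence enters here: the path events exhaust the space up to a null
    set.\<close>
  have cover: "AE \<omega> in M. \<omega> \<in> (\<Union>p\<in>I. G p)"
    using recurrent_return_AE[OF M S rec] AE_space
  proof eventually_elim
    case (elim \<omega>)
    define n where "n = return_time i S \<omega> - 1"
    have "n \<ge> 1" "Suc n = return_time i S \<omega>"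
      using return_time_props(1)[where S = S and i = i, of \<omega>, OF elim(1)] by (auto simp: n_def)
    then have "(n, restrict (\<lambda>k. S k \<omega>) {1..n}) \<in> I" "\<omega> \<in> G (n, restrict (\<lambda>k. S k \<omega>) {1..n})"
      using return_time_props[where S = S and i = i, of \<omega>, OF elim(1)] elim(2) by (auto simp: I_def G_def)
    then show ?case by blast
  qed
  have split: "emeasure M B = (\<integral>\<^sup>+ p. emeasure M (B \<inter> G p) \<partial>count_space I)" if [measurable]: "B \<in> sets M" for B
  proof -
    have "emeasure M B = emeasure M (\<Union>p\<in>I. B \<inter> G p)"
      using cover I by (intro emeasure_eq_AE sets.countable_UN'') (auto elim: eventually_mono)
    also have "\<dots> = (\<integral>\<^sup>+ p. emeasure M (B \<inter> G p) \<partial>count_space I)"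
    proof (rule emeasure_UN_countable)
      show "disjoint_family_on (\<lambda>p. B \<inter> G p) I"
        using disj unfolding disjoint_family_on_def by blast
    qed (use I in auto)
    finally show ?thesis .
  qed
  have key: "emeasure M {\<omega> \<in> space M. ?Y \<omega> \<in> A \<and> ?V \<omega> \<in> C} =
      (\<integral>\<^sup>+ p. emeasure M {\<omega> \<in> space M. restrict (\<lambda>j. X j \<omega>) {1..fst p} \<in>
        cycle_of (fst p) (snd p) -` A \<inter> space (PiM {1..fst p} (\<lambda>_. borel))} * emeasure M (G p) \<partial>count_space I) *
      emeasure M {\<omega> \<in> space M. ram_nu X S \<omega> \<in> C}"
    if [measurable]: "A \<in> sets (borel \<Otimes>\<^sub>M pm_space)" "C \<in> sets pm_space" for A C
  proof -
    have "emeasure M {\<omega> \<in> space M. ?Y \<omega> \<in> A \<and> ?V \<omega> \<in> C} =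
      (\<integral>\<^sup>+ p. emeasure M ({\<omega> \<in> space M. ?Y \<omega> \<in> A \<and> ?V \<omega> \<in> C} \<inter> G p) \<partial>count_space I)"
      by (rule split) measurable
    also have "\<dots> = (\<integral>\<^sup>+ p. emeasure M {\<omega> \<in> space M. restrict (\<lambda>j. X j \<omega>) {1..fst p} \<in>
        cycle_of (fst p) (snd p) -` A \<inter> space (PiM {1..fst p} (\<lambda>_. borel))} * emeasure M (G p) *
      emeasure M {\<omega> \<in> space M. ram_nu X S \<omega> \<in> C} \<partial>count_space I)"
    proof (rule nn_integral_cong)
      fix p assume "p \<in> space (count_space I)"
      then have p: "p \<in> I" by simp
      obtain n s where ns: "p = (n, s)" by (cases p)
      let ?B = "cycle_of n s -` A \<inter> space (PiM {1..n} (\<lambda>_. borel))"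
      let ?E = "nu_of -` C \<inter> space (frac_seqs \<Otimes>\<^sub>M state_seqs)"
      have nu_E: "{\<omega> \<in> space M. ram_nu X S \<omega> \<in> C} =
          {\<omega> \<in> space M. (restrict (\<lambda>j. X j \<omega>) {1..}, restrict (\<lambda>j. S j \<omega>) {1..}) \<in> ?E}"
        unfolding ram_nu_eq_nu_of[of X S] by (auto simp: space_pair_measure space_PiM)
      have G_p: "{\<omega> \<in> space M. (\<forall>k\<in>{1..n}. S k \<omega> = s k) \<and> S (Suc n) \<omega> = i} = G p"
        by (simp add: G_def ns)
      have cycle_E: "{\<omega> \<in> space M. ?Y \<omega> \<in> A \<and> ?V \<omega> \<in> C} \<inter> G p =
        {\<omega> \<in> space M. restrict (\<lambda>j. X j \<omega>) {1..n} \<in> ?B \<and>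
          (\<forall>k\<in>{1..n}. S k \<omega> = s k) \<and> S (Suc n) \<omega> = i \<and>
          (seq_shift n (\<lambda>j. X j \<omega>), seq_shift n (\<lambda>j. S j \<omega>)) \<in> ?E}"
      proof -
        have "?Y \<omega> = cycle_of n s (restrict (\<lambda>j. X j \<omega>) {1..n})"
          "?V \<omega> = nu_of (seq_shift n (\<lambda>j. X j \<omega>), seq_shift n (\<lambda>j. S j \<omega>))" if "\<omega> \<in> G p" for \<omega>
        proof -
          have R: "return_time i S \<omega> = Suc n"
            using W[OF p that] by (simp add: ns)
          show "?Y \<omega> = cycle_of n s (restrict (\<lambda>j. X j \<omega>) {1..n})"
            using that by (intro cycle_eq_cycle_of R) (auto simp: G_def ns)
          show "?V \<omega> = nu_of (seq_shift n (\<lambda>j. X j \<omega>), seq_shift n (\<lambda>j. S j \<omega>))"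
            by (simp add: nu_after_cycle_def R ram_nu_shift_eq_nu_of)
        qed
        moreover have "restrict (\<lambda>j. X j \<omega>) {1..n} \<in> space (PiM {1..n} (\<lambda>_. borel))"
          "(seq_shift n (\<lambda>j. X j \<omega>), seq_shift n (\<lambda>j. S j \<omega>)) \<in> space (frac_seqs \<Otimes>\<^sub>M state_seqs)" for \<omega>
          by (auto simp: space_PiM space_pair_measure seq_shift_def)
        moreover have "\<omega> \<in> G p \<longleftrightarrow> \<omega> \<in> space M \<and> (\<forall>k\<in>{1..n}. S k \<omega> = s k) \<and> S (Suc n) \<omega> = i" for \<omega>
          by (simp add: G_def ns)
        ultimately show ?thesis
          by (intro set_eqI) (simp only: Int_iff mem_Collect_eq vimage_eq, metis)
      qed
      \<comment> \<open>S plays both roles in \<open>joint_regeneration\<close>: the chain that is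
        cut and the fresh copy started at i.\<close>
      have "emeasure M ({\<omega> \<in> space M. ?Y \<omega> \<in> A \<and> ?V \<omega> \<in> C} \<inter> G p) =
          emeasure M {\<omega> \<in> space M. restrict (\<lambda>j. X j \<omega>) {1..n} \<in> ?B} * emeasure M (G p) *
          emeasure M {\<omega> \<in> space M. ram_nu X S \<omega> \<in> C}"
        unfolding nu_E cycle_E unfolding G_p[symmetric]
        by (intro joint_regeneration[OF M X ident S S XS XS] measurable_sets[OF measurable_cycle_of]
            measurable_sets[OF measurable_nu_of]) fact+
      then show "emeasure M ({\<omega> \<in> space M. ?Y \<omega> \<in> A \<and> ?V \<omega> \<in> C} \<inter> G p) =
        emeasure M {\<omega> \<in> space M. restrict (\<lambda>j. X j \<omega>) {1..fst p} \<in>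
          cycle_of (fst p) (snd p) -` A \<inter> space (PiM {1..fst p} (\<lambda>_. borel))} * emeasure M (G p) *
        emeasure M {\<omega> \<in> space M. ram_nu X S \<omega> \<in> C}"
        unfolding ns fst_conv snd_conv .
    qed
    also have "\<dots> = (\<integral>\<^sup>+ p. emeasure M {\<omega> \<in> space M. restrict (\<lambda>j. X j \<omega>) {1..fst p} \<in>
        cycle_of (fst p) (snd p) -` A \<inter> space (PiM {1..fst p} (\<lambda>_. borel))} * emeasure M (G p) \<partial>count_space I) *
      emeasure M {\<omega> \<in> space M. ram_nu X S \<omega> \<in> C}"
      by (rule nn_integral_multc) simp
    finally show ?thesis .
  qed
  show ?thesis
  proof (rule pair_measure_eqI)
    show "sigma_finite_measure (distr M (borel \<Otimes>\<^sub>M pm_space) ?Y)" "sigma_finite_measure (distr M pm_space (ram_nu X S))"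
      by (intro prob_space_imp_sigma_finite prob_space_distr; measurable)+
    fix A C assume "A \<in> sets (distr M (borel \<Otimes>\<^sub>M pm_space) ?Y)" "C \<in> sets (distr M pm_space (ram_nu X S))"
    then have [measurable]: "A \<in> sets (borel \<Otimes>\<^sub>M pm_space)" "C \<in> sets pm_space" by auto
    \<comment> \<open>Taking the whole space for \<open>C\<close> in \<open>key\<close> identifies
      the sum over paths as the probability that the cycle pair lies in \<open>A\<close>.\<close>
    have "emeasure M {\<omega> \<in> space M. ?Y \<omega> \<in> A} =
      emeasure M {\<omega> \<in> space M. ?Y \<omega> \<in> A \<and> ?V \<omega> \<in> space pm_space}"
      by (simp add: space_PiM)
    also have "\<dots> = (\<integral>\<^sup>+ p. emeasure M {\<omega> \<in> space M. restrict (\<lambda>j. X j \<omega>) {1..fst p} \<in>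
        cycle_of (fst p) (snd p) -` A \<inter> space (PiM {1..fst p} (\<lambda>_. borel))} * emeasure M (G p) \<partial>count_space I) *
      emeasure M {\<omega> \<in> space M. ram_nu X S \<omega> \<in> space pm_space}"
      by (rule key) auto
    also have "emeasure M {\<omega> \<in> space M. ram_nu X S \<omega> \<in> space pm_space} = 1"
      by (simp add: space_PiM emeasure_space_1)
    finally have "emeasure M {\<omega> \<in> space M. ?Y \<omega> \<in> A \<and> ?V \<omega> \<in> C} =
        emeasure M {\<omega> \<in> space M. ?Y \<omega> \<in> A} * emeasure M {\<omega> \<in> space M. ram_nu X S \<omega> \<in> C}"
      by (simp only: key[OF \<open>A \<in> sets (borel \<Otimes>\<^sub>M pm_space)\<close> \<open>C \<in> sets pm_space\<close>] mult_1_right)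
    then show "emeasure (distr M (borel \<Otimes>\<^sub>M pm_space) ?Y) A * emeasure (distr M pm_space (ram_nu X S)) C =
        emeasure (distr M ((borel \<Otimes>\<^sub>M pm_space) \<Otimes>\<^sub>M pm_space) (\<lambda>\<omega>. (?Y \<omega>, ?V \<omega>))) (A \<times> C)"
      by (simp only: emeasure_distr_eq[OF Y] emeasure_distr_eq[OF nu] emeasure_distr_eq[OF measurable_Pair[OF Y V]]
          \<open>A \<in> sets (borel \<Otimes>\<^sub>M pm_space)\<close> \<open>C \<in> sets pm_space\<close> pair_measureI mem_Times_iff fst_conv snd_conv)
  qed simp
qed

text \<open>Replacing the product by the joint law of cycle and remainder turns the right-hand side
  into the pathwise decomposition of \<open>ram_nu\<close>.\<close>

lemma ram_nu_fixpoint: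
  fixes S :: "nat \<Rightarrow> 'a \<Rightarrow> 'x::countable" and X :: "nat \<Rightarrow> 'a \<Rightarrow> real"
  assumes M: "prob_space M" and X: "prob_space.indep_vars M (\<lambda>_. borel) X {1..}"
    and ident: "\<forall>j\<ge>1. distr M borel (X j) = distr M borel (X 1)"
    and range: "\<forall>j\<ge>1. \<forall>\<omega>\<in>space M. X j \<omega> \<in> {0..1}"
    and S: "markov_chain M Q (return_pmf i) S"
    and XS: "indep_rv M frac_seqs (\<lambda>\<omega>. restrict (\<lambda>j. X j \<omega>) {1..})
      state_seqs (\<lambda>\<omega>. restrict (\<lambda>j. S j \<omega>) {1..})"
    and rec: "recurrent_state Q i"
  shows "distr M pm_space (ram_nu X S) =
    distr (distr M (borel \<Otimes>\<^sub>M pm_space) (\<lambda>\<omega>. (cycle_mass X i S \<omega>, cycle_meas X i S \<omega>)) \<Otimes>\<^sub>M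
      distr M pm_space (ram_nu X S)) pm_space
      (\<lambda>((x, \<eta>), \<nu>'). \<lambda>l. x * \<eta> l + (1 - x) * \<nu>' l)"
proof -
  interpret prob_space M by fact
  have X_meas: "X j \<in> borel_measurable M" if "j \<ge> 1" for j
    using X that by (auto simp: indep_vars_def)
  have S_meas: "S j \<in> measurable M (count_space UNIV)" if "j \<ge> 1" for j
    using that S by (auto intro: markov_chain_measurable)
  show ?thesis
    unfolding cycle_indep_after_cycle[OF M X ident S XS rec]
    by (subst distr_distr[OF measurable_affine_combination])
      (use range in \<open>auto intro!: distr_cong measurable_Pair measurable_cycle_mass measurable_cycle_meas
        measurable_nu_after_cycle X_meas S_meas ram_nu_cycle_decomposition\<close>)
qed

section \<open>The conditional laws\<close>

lemma
  fixes L :: "(('x::countable \<Rightarrow> real) \<times> 'x) measure"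
  assumes L: "sets L = sets law_space" and \<mu>: "distr L (count_space UNIV) snd = measure_pmf \<mu>"
  shows emeasure_law_fibre: "emeasure L (UNIV \<times> {i}) = ennreal (pmf \<mu> i)"
    and emeasure_cond_law: "C \<in> sets pm_space \<Longrightarrow>
      emeasure (cond_law L i) C = emeasure L (C \<times> {i}) / ennreal (pmf \<mu> i)"
proof -
  note [measurable_cong] = L
  have space_L: "space L = UNIV"
    using sets_eq_imp_space_eq[OF L] by (simp add: space_pair_measure space_PiM)
  have "emeasure (distr L (count_space UNIV) snd) {i} = emeasure L (snd -` {i} \<inter> space L)"
    by (rule emeasure_distr) auto
  moreover have "snd -` {i} \<inter> space L = UNIV \<times> {i}"
    by (auto simp: space_L)
  ultimately show fibre: "emeasure L (UNIV \<times> {i}) = ennreal (pmf \<mu> i)"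
    by (simp add: \<mu> emeasure_pmf_single)
  assume [measurable]: "C \<in> sets pm_space"
  have F: "{p \<in> space L. snd p = i} = UNIV \<times> {i}"
    by (auto simp: space_L)
  have [measurable]: "UNIV \<times> {i} \<in> sets L"
    unfolding F[symmetric] by measurable
  have "fst \<in> measurable (uniform_measure L (UNIV \<times> {i})) pm_space"
    by measurable
  then have "emeasure (cond_law L i) C = emeasure (uniform_measure L (UNIV \<times> {i})) (fst -` C \<inter> space L)"
    unfolding cond_law_def F by (subst emeasure_distr) auto
  also have "\<dots> = emeasure L ((UNIV \<times> {i}) \<inter> (fst -` C \<inter> space L)) / emeasure L (UNIV \<times> {i})"
    by (rule emeasure_uniform_measure) measurable
  also have "(UNIV \<times> {i}) \<inter> (fst -` C \<inter> space L) = C \<times> {i}"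
    by (auto simp: space_L)
  finally show "emeasure (cond_law L i) C = emeasure L (C \<times> {i}) / ennreal (pmf \<mu> i)"
    unfolding fibre .
qed

text \<open>A measurable set of pairs is the countable union of its fibres over the states.
  Conditional laws give the mass of each fibre charged by mu, and the other fibres are null under
  both laws because both have second marginal mu.\<close>

lemma law_eqI:
  fixes L L' :: "(('x::countable \<Rightarrow> real) \<times> 'x) measure"
  assumes L: "sets L = sets law_space" "distr L (count_space UNIV) snd = measure_pmf \<mu>"
    and L': "sets L' = sets law_space" "distr L' (count_space UNIV) snd = measure_pmf \<mu>"
    and cond: "\<And>i. pmf \<mu> i > 0 \<Longrightarrow> cond_law L i = cond_law L' i"
  shows "L = L'"
proof (rule measure_eqI)
  show "sets L = sets L'" using L L' by simp
  fix B assume "B \<in> sets L"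
  then have B: "B \<in> sets law_space" using L by simp
  define C where "C i = (\<lambda>v. (v, i)) -` B" for i
  have C [measurable]: "C i \<in> sets pm_space" for i
  proof -
    have "(\<lambda>v. (v, i)) -` B \<inter> space pm_space \<in> sets pm_space"
      by (rule measurable_sets[OF _ B]) simp
    then show ?thesis by (simp add: C_def space_PiM)
  qed
  have B_eq: "B = (\<Union>i. C i \<times> {i})"
    by (auto simp: C_def)
  have split: "emeasure N B = (\<integral>\<^sup>+ i. emeasure N (C i \<times> {i}) \<partial>count_space UNIV)"
    if "sets N = sets law_space" for N
    unfolding B_eq using that
    by (intro emeasure_UN_countable) (auto simp: disjoint_family_on_def)
  have "emeasure L (C i \<times> {i}) = emeasure L' (C i \<times> {i})" for i
  proof (cases "pmf \<mu> i > 0")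
    case True
    have "emeasure L (C i \<times> {i}) / ennreal (pmf \<mu> i) = emeasure L' (C i \<times> {i}) / ennreal (pmf \<mu> i)"
      using cond[OF True] emeasure_cond_law[OF L C, of i i] emeasure_cond_law[OF L' C, of i i] by simp
    then have "emeasure L (C i \<times> {i}) / ennreal (pmf \<mu> i) * ennreal (pmf \<mu> i) =
        emeasure L' (C i \<times> {i}) / ennreal (pmf \<mu> i) * ennreal (pmf \<mu> i)"
      by simp
    then show ?thesis
      using True by (simp add: ennreal_divide_times ennreal_times_divide[symmetric] ennreal_divide_self)
  next
    case False
    then have 0: "pmf \<mu> i = 0" using pmf_nonneg[of \<mu> i] by linarith
    have "UNIV \<times> {i} \<in> sets law_space"
      using pair_measureI[of "UNIV :: ('x \<Rightarrow> real) set" pm_space "{i}" "count_space UNIV"]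
        sets.top[of "pm_space :: ('x \<Rightarrow> real) measure"] by (simp add: space_PiM)
    then have "emeasure N (C i \<times> {i}) \<le> emeasure N (UNIV \<times> {i})" if "sets N = sets law_space" for N
      using that by (intro emeasure_mono) auto
    from this[OF L(1)] this[OF L'(1)] show ?thesis
      by (simp add: emeasure_law_fibre[OF L] emeasure_law_fibre[OF L'] 0)
  qed
  then show "emeasure L B = emeasure L' B"
    by (simp add: split[OF L(1)] split[OF L'(1)])
qed

text \<open>Regeneration at time 0: the prefix is empty, the condition is T_1 = i, and sequences
  shifted by 0 are the sequences themselves. So conditioning on T_1 = i amounts to starting from i a
  chain independent of the fractions.\<close>

lemma cond_law_ram_nu:
  fixes T S :: "nat \<Rightarrow> 'a \<Rightarrow> 'x::countable" and X :: "nat \<Rightarrow> 'a \<Rightarrow> real"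
  assumes M: "prob_space M" and X: "prob_space.indep_vars M (\<lambda>_. borel) X {1..}"
    and ident: "\<forall>j\<ge>1. distr M borel (X j) = distr M borel (X 1)"
    and T: "markov_chain M Q \<mu> T" and S: "markov_chain M Q (return_pmf i) S"
    and XT: "indep_rv M frac_seqs (\<lambda>\<omega>. restrict (\<lambda>j. X j \<omega>) {1..})
      state_seqs (\<lambda>\<omega>. restrict (\<lambda>j. T j \<omega>) {1..})"
    and XS: "indep_rv M frac_seqs (\<lambda>\<omega>. restrict (\<lambda>j. X j \<omega>) {1..})
      state_seqs (\<lambda>\<omega>. restrict (\<lambda>j. S j \<omega>) {1..})"
    and i: "pmf \<mu> i > 0"
    and \<mu>: "distr (distr M law_space (\<lambda>\<omega>. (ram_nu X T \<omega>, T 1 \<omega>))) (count_space UNIV) snd = measure_pmf \<mu>"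
  shows "cond_law (distr M law_space (\<lambda>\<omega>. (ram_nu X T \<omega>, T 1 \<omega>))) i = distr M pm_space (ram_nu X S)"
proof (rule measure_eqI)
  interpret prob_space M by fact
  have X_meas: "X j \<in> borel_measurable M" if "j \<ge> 1" for j
    using X that by (auto simp: indep_vars_def)
  have T_meas: "T j \<in> measurable M (count_space UNIV)" and S_meas: "S j \<in> measurable M (count_space UNIV)"
    if "j \<ge> 1" for j
    using that T S by (auto intro: markov_chain_measurable)
  have nu_T: "(\<lambda>\<omega>. (ram_nu X T \<omega>, T 1 \<omega>)) \<in> measurable M law_space"
    by (intro measurable_Pair measurable_ram_nu X_meas T_meas) auto
  have nu_S: "ram_nu X S \<in> measurable M pm_space"
    by (intro measurable_ram_nu X_meas S_meas)
  fix C assume "C \<in> sets (cond_law (distr M law_space (\<lambda>\<omega>. (ram_nu X T \<omega>, T 1 \<omega>))) i)"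
  then have C: "C \<in> sets pm_space"
    by (simp add: cond_law_def)
  let ?E = "nu_of -` C \<inter> space (frac_seqs \<Otimes>\<^sub>M state_seqs)"
  have E: "?E \<in> sets (frac_seqs \<Otimes>\<^sub>M state_seqs)"
    by (rule measurable_sets[OF measurable_nu_of C])
  have shift_0: "seq_shift 0 f = restrict f {1..}" for f :: "nat \<Rightarrow> 'c"
    by (simp add: seq_shift_def)
  have in_E: "(restrict (\<lambda>j. X j \<omega>) {1..}, restrict (\<lambda>j. R j \<omega>) {1..}) \<in> ?E \<longleftrightarrow> ram_nu X R \<omega> \<in> C"
    for R :: "nat \<Rightarrow> 'a \<Rightarrow> 'x" and \<omega>
    unfolding ram_nu_eq_nu_of[of X R] by (auto simp: space_pair_measure space_PiM)
  have "emeasure M {\<omega> \<in> space M. T 1 \<omega> = i \<and> ram_nu X T \<omega> \<in> C} =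
      emeasure M {\<omega> \<in> space M. T 1 \<omega> = i} * emeasure M {\<omega> \<in> space M. ram_nu X S \<omega> \<in> C}"
    using joint_regeneration[OF M X ident T S XT XS sets.top E, of 0 undefined]
    unfolding shift_0 in_E
    by (simp add: space_PiM restrict_def emeasure_space_1 One_nat_def[symmetric])
  also have "emeasure M {\<omega> \<in> space M. T 1 \<omega> = i} = ennreal (pmf \<mu> i)"
    using markov_chain_path[OF M T, of 1 "\<lambda>_. i"] by simp
  finally have *: "emeasure M {\<omega> \<in> space M. T 1 \<omega> = i \<and> ram_nu X T \<omega> \<in> C} =
      ennreal (pmf \<mu> i) * emeasure M {\<omega> \<in> space M. ram_nu X S \<omega> \<in> C}" .
  have "emeasure (distr M law_space (\<lambda>\<omega>. (ram_nu X T \<omega>, T 1 \<omega>))) (C \<times> {i}) =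
      emeasure M {\<omega> \<in> space M. T 1 \<omega> = i \<and> ram_nu X T \<omega> \<in> C}"
    by (subst emeasure_distr_eq[OF nu_T]) (use C in \<open>auto simp: conj_commute\<close>)
  then show "emeasure (cond_law (distr M law_space (\<lambda>\<omega>. (ram_nu X T \<omega>, T 1 \<omega>))) i) C =
      emeasure (distr M pm_space (ram_nu X S)) C"
    using i by (simp add: emeasure_cond_law[OF _ \<mu> C] * emeasure_distr_eq[OF nu_S C]
        ennreal_times_divide[symmetric] mult.commute[of "ennreal _"] ennreal_mult_divide_eq)
qed (simp add: cond_law_def)

lemma prob_space_cond_law:
  fixes L :: "(('x::countable \<Rightarrow> real) \<times> 'x) measure"
  assumes L: "sets L = sets law_space" and \<mu>: "distr L (count_space UNIV) snd = measure_pmf \<mu>"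
    and i: "pmf \<mu> i > 0"
  shows "prob_space (cond_law L i)"
proof
  have "UNIV \<in> sets (pm_space :: ('x \<Rightarrow> real) measure)"
    using sets.top[of "pm_space :: ('x \<Rightarrow> real) measure"] by (simp add: space_PiM)
  then show "emeasure (cond_law L i) (space (cond_law L i)) = 1"
    using i emeasure_cond_law[OF L \<mu>, of UNIV i]
    by (simp add: cond_law_def space_PiM emeasure_law_fibre[OF L \<mu>] ennreal_divide_self)
qed

lemma AE_cond_law_in_unit:
  fixes L :: "(('x::countable \<Rightarrow> real) \<times> 'x) measure"
  assumes L: "sets L = sets law_space" and AE_L: "AE p in L. \<forall>l. fst p l \<in> {0..1}"
  shows "AE v in cond_law L i. \<forall>l. v l \<in> {0..1}"
proof -
  note [measurable_cong] = L
  have F [measurable]: "{p \<in> space L. snd p = i} \<in> sets L"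
    by measurable
  have "AE p in uniform_measure L {p \<in> space L. snd p = i}. \<forall>l. fst p l \<in> {0..1}"
    using AE_L by (intro AE_uniform_measureI F) (auto elim: eventually_mono)
  \<comment> \<open>The quantifier over l is countable, which makes the event measurable.\<close>
  moreover have "{v \<in> space pm_space. \<forall>l. v l \<in> {0..1}} \<in> sets (pm_space :: ('x \<Rightarrow> real) measure)"
    by measurable
  ultimately show ?thesis
    unfolding cond_law_def by (subst AE_distr_iff) auto
qed

section \<open>Range and non-degeneracy of the cycle mass\<close>

lemma cycle_mass_in_unit:
  assumes X: "\<And>j. j \<ge> 1 \<Longrightarrow> X j \<omega> \<in> {0..1}"
  shows "cycle_mass X i S \<omega> \<in> {0..1}"
proof -
  have *: "{1..<return_time i S \<omega>} = {1..return_time i S \<omega> - 1}" by auto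
  have "0 \<le> (\<Prod>l\<in>{1..return_time i S \<omega> - 1}. 1 - X l \<omega>)" "(\<Prod>l\<in>{1..return_time i S \<omega> - 1}. 1 - X l \<omega>) \<le> 1"
    using X by (auto intro!: prod_nonneg prod_le_1)
  then show ?thesis
    unfolding cycle_mass_def * sum_ram_weight by simp
qed

text \<open>A return puts W above 1, so the first weight, which is X_1 itself, belongs to the cycle;
  without a return \<open>LEAST\<close> is unspecified and the cycle could be empty.\<close>

lemma first_fraction_le_cycle_mass:
  assumes X: "\<And>j. j \<ge> 1 \<Longrightarrow> X j \<omega> \<in> {0..1}" and ret: "\<exists>j>1. S j \<omega> = i"
  shows "X 1 \<omega> \<le> cycle_mass X i S \<omega>"
proof -
  have "X 1 \<omega> = (\<Sum>j\<in>{1}. ram_weight X j \<omega>)"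
    by (simp add: ram_weight_def)
  also have "\<dots> \<le> cycle_mass X i S \<omega>"
    unfolding cycle_mass_def using return_time_props(1)[where S = S and i = i, of \<omega>, OF ret]
    by (intro sum_mono2) (auto intro!: ram_weight_nonneg[of X \<omega>, OF X])
  finally show ?thesis .
qed

lemma cycle_mass_not_AE_zero:
  fixes S :: "nat \<Rightarrow> 'a \<Rightarrow> 'x::countable" and X :: "nat \<Rightarrow> 'a \<Rightarrow> real"
  assumes M: "prob_space M" and X_meas: "\<And>j. j \<ge> 1 \<Longrightarrow> X j \<in> borel_measurable M"
    and ident: "\<forall>j\<ge>1. distr M borel (X j) = distr M borel (X 1)"
    and range: "\<forall>j\<ge>1. \<forall>\<omega>\<in>space M. X j \<omega> \<in> {0..1}"
    and RAM: "AE \<omega> in M. (\<lambda>j. ram_weight X (Suc j) \<omega>) sums 1"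
    and S: "markov_chain M Q (return_pmf i) S" and rec: "recurrent_state Q i"
  shows "\<not> (AE \<omega> in M. cycle_mass X i S \<omega> = 0)"
proof
  interpret prob_space M by fact
  assume "AE \<omega> in M. cycle_mass X i S \<omega> = 0"
  then have "AE \<omega> in M. X 1 \<omega> = 0"
    using recurrent_return_AE[OF M S rec] AE_space
  proof eventually_elim
    case (elim \<omega>)
    have "X 1 \<omega> \<le> 0" "0 \<le> X 1 \<omega>"
      using first_fraction_le_cycle_mass[of X \<omega> S i] elim range by auto
    then show ?case by simp
  qed
  moreover have AE_iff: "(AE \<omega> in M. X j \<omega> = 0) \<longleftrightarrow> (AE x in distr M borel (X j). x = 0)" if "j \<ge> 1" for j
    by (subst AE_distr_iff[OF X_meas[OF that]]) auto
  ultimately have "AE x in distr M borel (X 1). x = 0"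
    by simp
  \<comment> \<open>Identical distribution carries the null event from X_1 to every X_j; then all
    weights vanish and cannot sum to 1.\<close>
  then have "AE x in distr M borel (X (Suc j)). x = 0" for j
    by (subst ident[rule_format]) simp_all
  then have "AE \<omega> in M. X (Suc j) \<omega> = 0" for j
    by (simp add: AE_iff)
  then have "AE \<omega> in M. \<forall>j. X (Suc j) \<omega> = 0"
    by (simp add: AE_all_countable)
  with RAM have "AE \<omega> in M. False"
  proof eventually_elim
    case (elim \<omega>)
    then have "(\<lambda>j. 0 :: real) sums 1"
      by (simp add: ram_weight_def)
    then show ?case
      using sums_unique2[OF sums_zero] by fastforce
  qed
  then show False
    by simp
qed

theorem mainTheorem7:
  fixes M :: "'a measure"
    and X :: "nat \<Rightarrow> 'a \<Rightarrow> real"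
    and T :: "nat \<Rightarrow> 'a \<Rightarrow> 'x::countable"
    and Ti :: "'x \<Rightarrow> nat \<Rightarrow> 'a \<Rightarrow> 'x"
    and Q :: "'x \<Rightarrow> 'x pmf"
    and \<mu> :: "'x pmf"
  assumes M: "prob_space M"
    and X_indep: "prob_space.indep_vars M (\<lambda>_. borel) X {1..}"
    and X_ident: "\<forall>j\<ge>1. distr M borel (X j) = distr M borel (X 1)"
    and X_range: "\<forall>j\<ge>1. \<forall>\<omega>\<in>space M. X j \<omega> \<in> {0..1}"
    and RAM: "AE \<omega> in M. (\<lambda>j. ram_weight X (Suc j) \<omega>) sums 1"
    and T_MC: "markov_chain M Q \<mu> T"
    and T_indep: "indep_rv M (PiM {1..} (\<lambda>_. (borel :: real measure))) (\<lambda>\<omega>. restrict (\<lambda>j. X j \<omega>) {1..})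
                    (PiM {1..} (\<lambda>_. count_space (UNIV :: 'x set))) (\<lambda>\<omega>. restrict (\<lambda>j. T j \<omega>) {1..})"
    and mu_trans: "\<forall>i. transient_state Q i \<longrightarrow> pmf \<mu> i = 0"
    and Ti_MC: "\<forall>i. recurrent_state Q i \<longrightarrow>
           markov_chain M Q (return_pmf i) (Ti i) \<and>
           indep_rv M (PiM {1..} (\<lambda>_. (borel :: real measure))) (\<lambda>\<omega>. restrict (\<lambda>j. X j \<omega>) {1..})
                       (PiM {1..} (\<lambda>_. count_space (UNIV :: 'x set))) (\<lambda>\<omega>. restrict (\<lambda>j. Ti i j \<omega>) {1..}) \<and>
           indep_rv M (PiM {1..} (\<lambda>_. count_space (UNIV :: 'x set))) (\<lambda>\<omega>. restrict (\<lambda>j. Ti i j \<omega>) {1..})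
                       law_space (\<lambda>\<omega>. (ram_nu X T \<omega>, T 1 \<omega>))"
  shows "ram_fixpoint_law Q \<mu>
           (\<lambda>i. distr M (borel \<Otimes>\<^sub>M pm_space) (\<lambda>\<omega>. (cycle_mass X i (Ti i) \<omega>, cycle_meas X i (Ti i) \<omega>)))
           (distr M law_space (\<lambda>\<omega>. (ram_nu X T \<omega>, T 1 \<omega>)))
       \<and> (\<forall>L. prob_space L \<and> sets L = sets law_space
              \<and> (AE p in L. (\<forall>l. 0 \<le> fst p l) \<and> (fst p has_sum 1) UNIV)
              \<and> ram_fixpoint_law Q \<mu>
                  (\<lambda>i. distr M (borel \<Otimes>\<^sub>M pm_space) (\<lambda>\<omega>. (cycle_mass X i (Ti i) \<omega>, cycle_meas X i (Ti i) \<omega>))) L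
              \<longrightarrow> L = distr M law_space (\<lambda>\<omega>. (ram_nu X T \<omega>, T 1 \<omega>)))"
proof -
  interpret prob_space M by fact
  define K where "K i = distr M (borel \<Otimes>\<^sub>M pm_space) (\<lambda>\<omega>. (cycle_mass X i (Ti i) \<omega>, cycle_meas X i (Ti i) \<omega>))" for i
  define L0 where "L0 = distr M law_space (\<lambda>\<omega>. (ram_nu X T \<omega>, T 1 \<omega>))"
  have X_meas: "X j \<in> borel_measurable M" if "j \<ge> 1" for j
    using X_indep that by (auto simp: indep_vars_def)
  have T_meas: "T j \<in> measurable M (count_space UNIV)" if "j \<ge> 1" for j
    using that T_MC by (auto intro: markov_chain_measurable)
  have nu_T: "(\<lambda>\<omega>. (ram_nu X T \<omega>, T 1 \<omega>)) \<in> measurable M law_space"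
    by (intro measurable_Pair measurable_ram_nu X_meas T_meas) auto
  have L0_sets: "sets L0 = sets law_space"
    by (simp add: L0_def)
  have L0_\<mu>: "distr L0 (count_space UNIV) snd = measure_pmf \<mu>"
  proof (rule measure_eqI_countable[of _ UNIV])
    fix y :: 'x
    have "emeasure (distr M (count_space UNIV) (T 1)) {y} = emeasure M {\<omega> \<in> space M. T 1 \<omega> \<in> {y}}"
      by (rule emeasure_distr_eq) (auto intro: T_meas)
    also have "\<dots> = ennreal (pmf \<mu> y)"
      using markov_chain_path[OF M T_MC, of 1 "\<lambda>_. y"] by simp
    finally show "emeasure (distr L0 (count_space UNIV) snd) {y} = emeasure (measure_pmf \<mu>) {y}"
      unfolding L0_def by (subst distr_distr[OF measurable_snd nu_T]) (simp add: comp_def emeasure_pmf_single)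
  qed auto
  \<comment> \<open>The hypothesis on transient states is used in contrapositive form: the equation
    is available for every state on which conditioning is possible.\<close>
  have rec: "recurrent_state Q i" if "pmf \<mu> i > 0" for i
    using mu_trans that by (force simp: transient_state_def)
  \<comment> \<open>The chains \<open>Ti i\<close> realise the conditional laws, so the equation for
    \<open>L0\<close> reduces to \<open>ram_nu_fixpoint\<close>.\<close>
  have cond_L0: "cond_law L0 i = distr M pm_space (ram_nu X (Ti i))" if "pmf \<mu> i > 0" for i
    unfolding L0_def using Ti_MC rec[OF that] that L0_\<mu>[unfolded L0_def]
    by (intro cond_law_ram_nu[OF M X_indep X_ident T_MC _ T_indep]) auto
  have L0_fix: "ram_fixpoint_law Q \<mu> K L0"
    unfolding ram_fixpoint_law_def
  proof (intro conjI allI impI L0_\<mu>)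
    fix i assume i: "recurrent_state Q i \<and> pmf \<mu> i > 0"
    show "cond_law L0 i = distr (K i \<Otimes>\<^sub>M cond_law L0 i) pm_space
            (\<lambda>((x, \<eta>), \<nu>'). \<lambda>l. x * \<eta> l + (1 - x) * \<nu>' l)"
      unfolding cond_L0[OF conjunct2[OF i]] K_def using Ti_MC i
      by (intro ram_nu_fixpoint[OF M X_indep X_ident X_range]) auto
  qed
  have "L = L0" if L: "prob_space L" "sets L = sets law_space"
    and supp: "AE p in L. (\<forall>l. 0 \<le> fst p l) \<and> (fst p has_sum 1) UNIV"
    and L_fix: "ram_fixpoint_law Q \<mu> K L" for L
  proof (rule law_eqI[OF L(2) _ L0_sets L0_\<mu>])
    show L_\<mu>: "distr L (count_space UNIV) snd = measure_pmf \<mu>"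
      using L_fix by (simp add: ram_fixpoint_law_def)
    fix i assume i: "pmf \<mu> i > 0"
    have S: "markov_chain M Q (return_pmf i) (Ti i)"
      using Ti_MC rec[OF i] by auto
    have Y: "(\<lambda>\<omega>. (cycle_mass X i (Ti i) \<omega>, cycle_meas X i (Ti i) \<omega>)) \<in> measurable M (borel \<Otimes>\<^sub>M pm_space)"
      by (intro measurable_Pair measurable_cycle_mass measurable_cycle_meas X_meas markov_chain_measurable[OF S])
    have AE_K: "(AE p in K i. P (fst p)) \<longleftrightarrow> (AE \<omega> in M. P (cycle_mass X i (Ti i) \<omega>))"
      if [measurable]: "Measurable.pred borel P" for P
    proof -
      have "{p \<in> space (borel \<Otimes>\<^sub>M pm_space). P (fst p)} \<in> sets (borel \<Otimes>\<^sub>M (pm_space :: ('x \<Rightarrow> real) measure))"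
        by measurable
      then show ?thesis
        unfolding K_def by (subst AE_distr_iff[OF Y]) auto
    qed
    \<comment> \<open>Nonnegative entries summing to 1 are at most 1 each; this gives a competing
      law the bounded support that the starting bound of the contraction uses.\<close>
    have L_unit: "AE p in L. \<forall>l. fst p l \<in> {0..1}"
      using supp
    proof (rule eventually_mono)
      fix p :: "('x \<Rightarrow> real) \<times> 'x" assume p: "(\<forall>l. 0 \<le> fst p l) \<and> (fst p has_sum 1) UNIV"
      have "sum (fst p) {l} \<le> 1" for l
        using p by (intro finite_sum_le_has_sum[where f = "fst p" and S = 1 and A = UNIV]) auto
      then show "\<forall>l. fst p l \<in> {0..1}"
        using p by simp
    qed
    have "AE p in L0. \<forall>l. fst p l \<in> {0..1}"
    proof -
      have "{p \<in> space law_space. \<forall>l. fst p l \<in> {0..1}} \<in> sets (law_space :: (('x \<Rightarrow> real) \<times> 'x) measure)"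
        by measurable
      moreover have "ram_nu X T \<omega> l \<in> {0..1}" if "\<omega> \<in> space M" for \<omega> l
        by (rule ram_nu_in_unit) (use X_range that in auto)
      ultimately show ?thesis
        unfolding L0_def by (subst AE_distr_iff[OF nu_T]) (auto intro: AE_I2)
    qed
    then have L0_unit: "AE v in cond_law L0 i. \<forall>l. v l \<in> {0..1}"
      by (rule AE_cond_law_in_unit[OF L0_sets])
    show "cond_law L i = cond_law L0 i"
    proof (rule affine_fixpoint_unique[of "K i"])
      show "prob_space (K i)"
        unfolding K_def by (rule prob_space_distr[OF Y])
      show "sets (K i) = sets (borel \<Otimes>\<^sub>M pm_space)"
        by (simp add: K_def)
      show "AE p in K i. fst p \<in> {0..1}"
      proof (subst AE_K)
        have "cycle_mass X i (Ti i) \<omega> \<in> {0..1}" if "\<omega> \<in> space M" for \<omega>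
          by (rule cycle_mass_in_unit) (use X_range that in auto)
        then show "AE \<omega> in M. cycle_mass X i (Ti i) \<omega> \<in> {0..1}"
          by (rule AE_I2)
      qed simp
      show "\<not> (AE p in K i. fst p = 0)"
        using cycle_mass_not_AE_zero[OF M X_meas X_ident X_range RAM S rec[OF i]] by (subst AE_K) auto
      fix N assume "N \<in> {cond_law L i, cond_law L0 i}"
      moreover have "prob_space (cond_law L i)" "prob_space (cond_law L0 i)"
        by (rule prob_space_cond_law[OF L(2) L_\<mu> i] prob_space_cond_law[OF L0_sets L0_\<mu> i])+
      moreover have "sets (cond_law L i) = sets pm_space" "sets (cond_law L0 i) = sets pm_space"
        by (simp_all add: cond_law_def)
      moreover have "cond_law N i = distr (K i \<Otimes>\<^sub>M cond_law N i) pm_space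
          (\<lambda>((x, \<eta>), \<nu>'). \<lambda>l. x * \<eta> l + (1 - x) * \<nu>' l)" if "N \<in> {L, L0}" for N
        using that L_fix L0_fix rec[OF i] i unfolding ram_fixpoint_law_def by blast
      ultimately show "prob_space N \<and> sets N = sets pm_space \<and> (AE v in N. \<forall>l. v l \<in> {0..1}) \<and>
          N = distr (K i \<Otimes>\<^sub>M N) pm_space (\<lambda>((x, \<eta>), \<nu>'). \<lambda>l. x * \<eta> l + (1 - x) * \<nu>' l)"
        using AE_cond_law_in_unit[OF L(2) L_unit, of i] L0_unit by (elim insertE emptyE) (simp_all only:, blast+)
    qed
  qed
  with L0_fix show ?thesis
    unfolding K_def L0_def by blast
qed

end
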